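(* Let $m\geq 2$ be an integer and let $Q_m$ be the B-spline of order $m$. For $\alpha\in\mathbb{R}$ put $$\Lambda_{\alpha}=\left\{\left\langle\tfrac{m}{2}\right\rangle+n:n\in\mathbb{N}_0\right\}\cup\left\{\alpha+\left\langle\tfrac{m}{2}\right\rangle+n:n\in\mathbb{N}^{-}\right\}.$$ Then $\Lambda_\alpha$ is a complete interpolation set for $V(Q_m)$ if and only if $|\alpha|<1/2$.
   Context: $\mathbb{N}_0=\{0,1,2,\dots\}$, $\mathbb{N}^{-}=\{-1,-2,\dots\}$, and $\langle x\rangle$ denotes the fractional part of $x$. The B-splines are defined by $Q_1=\chi_{[0,1)}$ and $Q_{m+1}(x)=\int_{-\infty}^{\infty}Q_m(x-t)Q_1(t)\,dt$; $Q_m$ is supported on $[0,m]$ and $\{Q_m(\cdot-n):n\in\mathbb{Z}\}$ is a Riesz basis of $V(Q_m)$. For $\phi\in L^2(\mathbb{R})$, $V(\phi)=\{\sum_{k\in\mathbb{Z}}c_k\phi(\cdot-k):(c_k)\in\ell^2(\mathbb{Z})\}\subset L^2(\mathbb{R})$. A countable set $\Gamma=\{x_n\}\subset\mathbb{R}$ is a set of stable sampling for $V(\phi)$ if there are constants $A,B>0$ with $A\|f\|_2^2\le\sum_n|f(x_n)|^2\le B\|f\|_2^2$ for all $f\in V(\phi)$; it is a set of interpolation if for every $(c_n)\in\ell^2$ there is $f\in V(\phi)$ with $f(x_n)=c_n$ for all $n$; it is a complete interpolation set if it is both.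
   Formalization: Λ_α is read as a family indexed by the integers, repeated points counted twice; as a plain set the claim fails for positive integers α (Λ_1 = Λ_0). Functions and coefficients are real-valued, equivalent to the complex case via real and imaginary parts. *)

theory Defs
  imports "HOL-Analysis.Analysis"
begin

text \<open>B-splines: Q_1 = indicator of [0,1), Q_(m+1)(x) = integral of Q_m(x-t) Q_1(t) dt.
  The index 0 is a dummy value (never used).\<close>
fun Bspline :: "nat \<Rightarrow> real \<Rightarrow> real" where
  "Bspline 0 = (\<lambda>x. 0)"
| "Bspline (Suc 0) = indicator {0..<1}"
| "Bspline (Suc (Suc n)) = (\<lambda>x. LINT t|lborel. Bspline (Suc n) (x - t) * indicator {0..<1} t)"

definition shift_space :: "(real \<Rightarrow> real) \<Rightarrow> (real \<Rightarrow> real) set" where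
  "shift_space \<phi> = {f. \<exists>c :: int \<Rightarrow> real. (\<lambda>k. (c k)\<^sup>2) summable_on UNIV \<and>
       (\<forall>x. f x = (\<Sum>\<^sub>\<infinity>k. c k * \<phi> (x - of_int k)))}"

definition L2_norm_sq :: "(real \<Rightarrow> real) \<Rightarrow> real" where
  "L2_norm_sq f = (LINT x|lborel. (f x)\<^sup>2)"

text \<open>Sampling families are indexed by integers (repetitions allowed).\<close>
definition stable_sampling :: "(int \<Rightarrow> real) \<Rightarrow> (real \<Rightarrow> real) set \<Rightarrow> bool" where
  "stable_sampling X V \<longleftrightarrow> (\<exists>A B. A > 0 \<and> B > 0 \<and> (\<forall>f\<in>V.
      (\<lambda>n. (f (X n))\<^sup>2) summable_on UNIV \<and>
      A * L2_norm_sq f \<le> (\<Sum>\<^sub>\<infinity>n. (f (X n))\<^sup>2) \<and>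
      (\<Sum>\<^sub>\<infinity>n. (f (X n))\<^sup>2) \<le> B * L2_norm_sq f))"

definition interpolation_set :: "(int \<Rightarrow> real) \<Rightarrow> (real \<Rightarrow> real) set \<Rightarrow> bool" where
  "interpolation_set X V \<longleftrightarrow> (\<forall>c :: int \<Rightarrow> real. (\<lambda>n. (c n)\<^sup>2) summable_on UNIV \<longrightarrow>
      (\<exists>f\<in>V. \<forall>n. f (X n) = c n))"

definition complete_interpolation_set :: "(int \<Rightarrow> real) \<Rightarrow> (real \<Rightarrow> real) set \<Rightarrow> bool" where
  "complete_interpolation_set X V \<longleftrightarrow> stable_sampling X V \<and> interpolation_set X V"

definition Lambda :: "nat \<Rightarrow> real \<Rightarrow> int \<Rightarrow> real" where
  "Lambda m \<alpha> n = (if n \<ge> 0 then frac (real m / 2) + of_int n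
                    else \<alpha> + frac (real m / 2) + of_int n)"

end

theory Submission
  imports Defs
begin

text \<open>
  Sampling a spline on \<open>\<langle>m/2\<rangle> + x + \<int>\<close> convolves its coefficients with the values
  \<open>Q\<^sub>m(m/2 + x + j)\<close>; let \<open>F\<^sub>x(\<theta>) = \<Sum>\<^sub>j Q\<^sub>m(m/2 + x + j) e\<^sup>i\<^sup>j\<^sup>\<theta>\<close> be the symbol. Since
  \<open>Q\<^sub>m\<^sub>+\<^sub>1' = Q\<^sub>m - Q\<^sub>m(\<cdot> - 1)\<close>, an induction on \<open>m\<close> confines \<open>F\<^sub>x(\<theta>)\<close>, for \<open>0 \<le> x < 1/2\<close> and
  \<open>0 < \<theta> \<le> \<pi>\<close>, to a sector of the right half plane, and \<open>F\<^sub>0\<close> is real. So the convolution operators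
  \<open>B\<close> of \<open>F\<^sub>\<alpha>\<close> and \<open>A\<close> of \<open>F\<^sub>0\<close> satisfy \<open>\<langle>A c, c\<rangle> \<ge> \<delta> \<parallel>c\<parallel>\<^sup>2\<close> and \<open>\<langle>B c, A c\<rangle> \<ge> \<delta> \<parallel>c\<parallel>\<^sup>2\<close> when
  \<open>\<bar>\<alpha>\<bar> < 1/2\<close>, which by Lax--Milgram makes the sampling operator, equal to \<open>A\<close> on the nonnegative
  and to \<open>B\<close> on the negative indices, invertible on \<open>\<ell>\<^sup>2(\<int>)\<close>.

  If \<open>\<alpha>\<close> is within distance less than \<open>1/2\<close> of an integer \<open>s \<noteq> 0\<close>, the sampling set arises from such
  a complete interpolation set by adding or deleting \<open>\<bar>s\<bar>\<close> points. If \<open>\<alpha>\<close> is a half-integer, then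
  \<open>F\<^sub>1\<^sub>/\<^sub>2(\<pi>) = 0\<close>, and long blocks of the coefficients \<open>(-1)\<^sup>k\<close> violate the lower sampling bound.
\<close>

section \<open>Square-summable sequences\<close>

lemma square_summable_mult:
  fixes c d :: "'i \<Rightarrow> real"
  assumes "(\<lambda>k. (c k)\<^sup>2) summable_on A" "(\<lambda>k. (d k)\<^sup>2) summable_on A"
  shows "(\<lambda>k. c k * d k) summable_on A"
proof -
  have "(\<lambda>k. (c k)\<^sup>2 + (d k)\<^sup>2) summable_on A"
    using assms by (rule summable_on_add)
  moreover have "norm (c k * d k) \<le> (c k)\<^sup>2 + (d k)\<^sup>2" for k
  proof -
    have "2 * (\<bar>c k\<bar> * \<bar>d k\<bar>) \<le> (c k)\<^sup>2 + (d k)\<^sup>2"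
      using sum_squares_bound[of "\<bar>c k\<bar>" "\<bar>d k\<bar>"] by simp
    moreover have "0 \<le> \<bar>c k\<bar> * \<bar>d k\<bar>" by simp
    ultimately show ?thesis unfolding real_norm_def abs_mult by linarith
  qed
  ultimately have "(\<lambda>k. norm (c k * d k)) summable_on A"
    by (rule summable_on_comparison_test) auto
  then show ?thesis
    by (rule abs_summable_summable)
qed

lemma square_summable_add:
  fixes c d :: "'i \<Rightarrow> real"
  assumes "(\<lambda>k. (c k)\<^sup>2) summable_on A" "(\<lambda>k. (d k)\<^sup>2) summable_on A"
  shows "(\<lambda>k. (c k + d k)\<^sup>2) summable_on A"
proof -
  have "(\<lambda>k. (c k)\<^sup>2 + (d k)\<^sup>2 + 2 * (c k * d k)) summable_on A"
    using assms by (intro summable_on_add summable_on_cmult_right square_summable_mult)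
  then show ?thesis
    by (simp add: power2_sum algebra_simps)
qed

text \<open>A type of its own makes the classes \<open>real_inner\<close> and
  \<open>complete_space\<close> available, and with them the Banach fixed point theorem.\<close>

typedef ell2 = "{c :: int \<Rightarrow> real. (\<lambda>k. (c k)\<^sup>2) summable_on UNIV}"
  morphisms coord Abs_ell2
  by (rule exI[of _ "\<lambda>_. 0"]) simp

setup_lifting type_definition_ell2

lemma coord_square_summable: "(\<lambda>k. (coord c k)\<^sup>2) summable_on UNIV"
  using coord[of c] by simp

lemma coord_Abs_ell2: "(\<lambda>k. (c k)\<^sup>2) summable_on UNIV \<Longrightarrow> coord (Abs_ell2 c) = c"
  by (simp add: Abs_ell2_inverse)

lemma ell2_eqI: "(\<And>k. coord c k = coord d k) \<Longrightarrow> c = d"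
  by (metis coord_inject ext)

instantiation ell2 :: real_inner
begin

lift_definition zero_ell2 :: ell2 is "\<lambda>_. 0" by simp

lift_definition plus_ell2 :: "ell2 \<Rightarrow> ell2 \<Rightarrow> ell2" is "\<lambda>c d k. c k + d k"
  by (rule square_summable_add)

lift_definition uminus_ell2 :: "ell2 \<Rightarrow> ell2" is "\<lambda>c k. - c k" by simp

lift_definition minus_ell2 :: "ell2 \<Rightarrow> ell2 \<Rightarrow> ell2" is "\<lambda>c d k. c k - d k"
  using square_summable_add[of _ _ "\<lambda>k. - _ k"] by simp

lift_definition scaleR_ell2 :: "real \<Rightarrow> ell2 \<Rightarrow> ell2" is "\<lambda>r c k. r * c k"
  by (simp add: power_mult_distrib summable_on_cmult_right)

lift_definition inner_ell2 :: "ell2 \<Rightarrow> ell2 \<Rightarrow> real" is "\<lambda>c d. \<Sum>\<^sub>\<infinity>k. c k * d k" .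

definition norm_ell2 :: "ell2 \<Rightarrow> real" where "norm_ell2 c = sqrt (c \<bullet> c)"
definition dist_ell2 :: "ell2 \<Rightarrow> ell2 \<Rightarrow> real" where "dist_ell2 c d = norm (c - d)"
definition sgn_ell2 :: "ell2 \<Rightarrow> ell2" where "sgn_ell2 c = scaleR (inverse (norm c)) c"
definition uniformity_ell2 :: "(ell2 \<times> ell2) filter" where
  "uniformity_ell2 = (INF e\<in>{0<..}. principal {(x, y). dist x y < e})"
definition open_ell2 :: "ell2 set \<Rightarrow> bool" where
  "open_ell2 U = (\<forall>x\<in>U. eventually (\<lambda>(x', y). x' = x \<longrightarrow> y \<in> U) uniformity)"

instance
proof
  fix x y z :: ell2 and a b :: real and U :: "ell2 set"
  show "x + y + z = x + (y + z)" "x + y = y + x" "0 + x = x" "- x + x = 0" "x - y = x + - y"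
    "a *\<^sub>R (x + y) = a *\<^sub>R x + a *\<^sub>R y" "(a + b) *\<^sub>R x = a *\<^sub>R x + b *\<^sub>R x"
    "a *\<^sub>R b *\<^sub>R x = (a * b) *\<^sub>R x" "1 *\<^sub>R x = x"
    by (transfer; force simp: algebra_simps)+
  show "dist x y = norm (x - y)" "sgn x = inverse (norm x) *\<^sub>R x" "norm x = sqrt (x \<bullet> x)"
    "uniformity = (INF e\<in>{0<..}. principal {(x, y). dist (x :: ell2) y < e})"
    "open U = (\<forall>x\<in>U. eventually (\<lambda>(x', y). x' = x \<longrightarrow> y \<in> U) uniformity)"
    by (simp_all add: dist_ell2_def sgn_ell2_def norm_ell2_def uniformity_ell2_def open_ell2_def)
  show "x \<bullet> y = y \<bullet> x"
    by transfer (simp add: mult.commute)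
  show "(x + y) \<bullet> z = x \<bullet> z + y \<bullet> z"
    by transfer (simp add: distrib_right infsum_add square_summable_mult)
  show "(a *\<^sub>R x) \<bullet> y = a * (x \<bullet> y)"
    by transfer (simp add: mult.assoc infsum_cmult_right square_summable_mult)
  show "0 \<le> x \<bullet> x"
    by transfer (simp add: infsum_nonneg)
  show "(x \<bullet> x = 0) = (x = 0)"
  proof
    assume "x \<bullet> x = 0"
    then have "(\<Sum>\<^sub>\<infinity>k. (coord x k)\<^sup>2) = 0"
      by (simp add: inner_ell2.rep_eq power2_eq_square)
    then have "(coord x k)\<^sup>2 = 0" for k
      using coord_square_summable[of x]
      by (intro nonneg_infsum_le_0D[where f = "\<lambda>k. (coord x k)\<^sup>2" and A = UNIV]) auto
    then show "x = 0"
      by (intro ell2_eqI) (simp add: zero_ell2.rep_eq)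
  qed (simp add: inner_ell2.rep_eq zero_ell2.rep_eq)
qed

end

lemmas coord_simps [simp] =
  zero_ell2.rep_eq plus_ell2.rep_eq uminus_ell2.rep_eq minus_ell2.rep_eq scaleR_ell2.rep_eq

lemma coord_sum [simp]: "coord (sum f A) k = (\<Sum>i\<in>A. coord (f i) k)"
  by (induction A rule: infinite_finite_induct) auto

lemma norm_ell2_square: "(norm c)\<^sup>2 = (\<Sum>\<^sub>\<infinity>k. (coord c k)\<^sup>2)"
  unfolding power2_norm_eq_inner inner_ell2.rep_eq by (simp add: power2_eq_square)

lemma sum_coord_square_le: "finite F \<Longrightarrow> (\<Sum>k\<in>F. (coord c k)\<^sup>2) \<le> (norm c)\<^sup>2"
  unfolding norm_ell2_square
  by (intro finite_sum_le_infsum coord_square_summable) auto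

lemma abs_coord_le_norm: "\<bar>coord c k\<bar> \<le> norm c"
  using sum_coord_square_le[of "{k}" c] by (simp add: abs_le_square_iff[symmetric])

text \<open>Limits are taken coordinatewise. On every finite index set the Cauchy estimate survives
  the limit with the same bound, so it controls the whole sum; this gives both the membership of the
  limit and convergence in norm.\<close>

instance ell2 :: complete_space
proof
  fix X :: "nat \<Rightarrow> ell2"
  assume X: "Cauchy X"
  have "Cauchy (\<lambda>n. coord (X n) k)" for k
  proof (rule CauchyI)
    fix e :: real assume "e > 0"
    then obtain M where M: "\<forall>m\<ge>M. \<forall>n\<ge>M. norm (X m - X n) < e"
      using X by (metis CauchyD)
    have "norm (coord (X m) k - coord (X n) k) < e" if "m \<ge> M" "n \<ge> M" for m n
      using abs_coord_le_norm[of "X m - X n" k] M that by (simp add: le_less_trans)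
    then show "\<exists>M. \<forall>m\<ge>M. \<forall>n\<ge>M. norm (coord (X m) k - coord (X n) k) < e"
      by blast
  qed
  then have "\<forall>k. \<exists>l. (\<lambda>n. coord (X n) k) \<longlonglongrightarrow> l"
    using Cauchy_convergent convergent_def by blast
  then obtain l where l: "\<And>k. (\<lambda>n. coord (X n) k) \<longlonglongrightarrow> l k"
    by metis
  have bound: "(\<Sum>k\<in>F. (coord (X m) k - l k)\<^sup>2) \<le> e\<^sup>2"
    if "finite F" "e > 0" "\<forall>m\<ge>M. \<forall>n\<ge>M. norm (X m - X n) < e" "m \<ge> M" for F e M m
  proof (rule LIMSEQ_le_const2)
    show "(\<lambda>n. \<Sum>k\<in>F. (coord (X m) k - coord (X n) k)\<^sup>2) \<longlonglongrightarrow> (\<Sum>k\<in>F. (coord (X m) k - l k)\<^sup>2)"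
      by (intro tendsto_intros l)
    have "(\<Sum>k\<in>F. (coord (X m) k - coord (X n) k)\<^sup>2) \<le> e\<^sup>2" if "n \<ge> M" for n
    proof -
      have "(\<Sum>k\<in>F. (coord (X m) k - coord (X n) k)\<^sup>2) \<le> (norm (X m - X n))\<^sup>2"
        using sum_coord_square_le[OF \<open>finite F\<close>, of "X m - X n"] by simp
      also have "\<dots> \<le> e\<^sup>2"
        using that \<open>m \<ge> M\<close> \<open>\<forall>m\<ge>M. \<forall>n\<ge>M. norm (X m - X n) < e\<close>
        by (intro power_mono) (auto intro: less_imp_le)
      finally show ?thesis .
    qed
    then show "\<exists>N. \<forall>n\<ge>N. (\<Sum>k\<in>F. (coord (X m) k - coord (X n) k)\<^sup>2) \<le> e\<^sup>2"
      by blast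
  qed
  have summable: "(\<lambda>k. (coord (X m) k - l k)\<^sup>2) summable_on UNIV"
    if "e > 0" "\<forall>m\<ge>M. \<forall>n\<ge>M. norm (X m - X n) < e" "m \<ge> M" for e M m
  proof (rule nonneg_bdd_above_summable_on)
    show "bdd_above (sum (\<lambda>k. (coord (X m) k - l k)\<^sup>2) ` {F. F \<subseteq> UNIV \<and> finite F})"
      using bound[OF _ that] by (intro bdd_aboveI[of _ "e\<^sup>2"]) blast
  qed auto
  obtain M where M: "\<forall>m\<ge>M. \<forall>n\<ge>M. norm (X m - X n) < 1"
    using X by (metis CauchyD zero_less_one)
  have "(\<lambda>k. (- (coord (X M) k - l k))\<^sup>2) summable_on UNIV"
    using summable[of 1 M M] M by (simp only: power2_minus)
  then have "(\<lambda>k. (coord (X M) k + - (coord (X M) k - l k))\<^sup>2) summable_on UNIV"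
    by (intro square_summable_add coord_square_summable)
  then have l2: "(\<lambda>k. (l k)\<^sup>2) summable_on UNIV"
    by simp
  define L where "L = Abs_ell2 l"
  have L: "coord L = l"
    using l2 by (simp add: L_def coord_Abs_ell2)
  have "X \<longlonglongrightarrow> L"
  proof (rule LIMSEQ_I)
    fix r :: real assume "r > 0"
    define e where "e = r / 2"
    have "e > 0" "e < r" using \<open>r > 0\<close> by (auto simp: e_def)
    then obtain M where M: "\<forall>m\<ge>M. \<forall>n\<ge>M. norm (X m - X n) < e"
      using X by (metis CauchyD)
    have "norm (X m - L) < r" if "m \<ge> M" for m
    proof -
      have "(\<Sum>k\<in>F. (coord (X m - L) k)\<^sup>2) \<le> e\<^sup>2" if "finite F" for F
        using bound[OF that \<open>e > 0\<close> M \<open>m \<ge> M\<close>] by (simp add: L)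
      then have "(norm (X m - L))\<^sup>2 \<le> e\<^sup>2"
        unfolding norm_ell2_square by (rule infsum_le_finite_sums[OF coord_square_summable])
      then have "norm (X m - L) \<le> e"
        using \<open>e > 0\<close> by (simp add: abs_le_square_iff[symmetric])
      then show ?thesis using \<open>e < r\<close> by simp
    qed
    then show "\<exists>no. \<forall>n\<ge>no. norm (X n - L) < r" by blast
  qed
  then show "convergent X"
    by (rule convergentI)
qed

section \<open>Shifts and restrictions of sequences\<close>

lift_definition shift :: "int \<Rightarrow> ell2 \<Rightarrow> ell2" is "\<lambda>j c k. c (k - j)"
proof -
  fix j :: int and c :: "int \<Rightarrow> real"
  assume "(\<lambda>k. (c k)\<^sup>2) summable_on UNIV"
  then show "(\<lambda>k. (c (k - j))\<^sup>2) summable_on UNIV"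
    using bij_plus_right[of "- j"] summable_on_reindex_bij_betw[of "\<lambda>k. k - j" UNIV UNIV "\<lambda>k. (c k)\<^sup>2"]
    by simp
qed

lift_definition restrict_ell2 :: "int set \<Rightarrow> ell2 \<Rightarrow> ell2" is "\<lambda>A c k. if k \<in> A then c k else 0"
  by (rule summable_on_comparison_test) auto

lemmas coord_shift [simp] = shift.rep_eq
lemmas coord_restrict [simp] = restrict_ell2.rep_eq

lemma inner_shift_shift: "shift i c \<bullet> shift j d = shift (i - j) c \<bullet> d"
proof -
  define g where "g k = coord c (k - i) * coord d (k - j)" for k
  have "shift i c \<bullet> shift j d = (\<Sum>\<^sub>\<infinity>k. g k)"
    by (simp add: inner_ell2.rep_eq g_def)
  also have "\<dots> = (\<Sum>\<^sub>\<infinity>k. g (k + j))"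
    using infsum_reindex_bij_betw[OF bij_plus_right[of j], of g] by simp
  also have "\<dots> = shift (i - j) c \<bullet> d"
    by (simp add: inner_ell2.rep_eq g_def diff_diff_eq2)
  finally show ?thesis .
qed

lemma norm_shift [simp]: "norm (shift j c) = norm c"
  by (simp add: norm_eq_sqrt_inner inner_shift_shift) (simp add: inner_ell2.rep_eq)

lemma bounded_linear_shift: "bounded_linear (shift j)"
  by (rule bounded_linear_intro[of _ 1]) (auto intro!: ell2_eqI)

lemma norm_restrict_le: "norm (restrict_ell2 A c) \<le> norm c"
proof -
  have "(norm (restrict_ell2 A c))\<^sup>2 \<le> (norm c)\<^sup>2"
    unfolding norm_ell2_square by (intro infsum_mono coord_square_summable) auto
  then show ?thesis by (simp add: abs_le_square_iff[symmetric])
qed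

lemma bounded_linear_restrict: "bounded_linear (restrict_ell2 A)"
  by (rule bounded_linear_intro[of _ 1]) (auto intro!: ell2_eqI simp: norm_restrict_le)

text \<open>Restrictions are orthogonal projections; this form splits inner products into
  blocks.\<close>

lemma inner_restrict: "restrict_ell2 A c \<bullet> d = restrict_ell2 A c \<bullet> restrict_ell2 A d"
  by (simp add: inner_ell2.rep_eq) (intro infsum_cong, auto)

text \<open>The squared error is the full sum of squares minus a partial sum. This density of
  finitely supported sequences carries inequalities from finite sums over to
  \<open>ell2\<close>.\<close>

lemma restrict_tendsto: "((\<lambda>F. restrict_ell2 F c) \<longlongrightarrow> c) (finite_subsets_at_top UNIV)"
proof -
  have "((\<lambda>F. \<Sum>k\<in>F. (coord c k)\<^sup>2) \<longlongrightarrow> (norm c)\<^sup>2) (finite_subsets_at_top UNIV)"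
    unfolding norm_ell2_square using infsum_tendsto[OF coord_square_summable[of c]] .
  then have "((\<lambda>F. sqrt ((norm c)\<^sup>2 - (\<Sum>k\<in>F. (coord c k)\<^sup>2))) \<longlongrightarrow> sqrt ((norm c)\<^sup>2 - (norm c)\<^sup>2))
      (finite_subsets_at_top UNIV)"
    by (intro tendsto_intros)
  moreover
  have "norm (restrict_ell2 F c - c) = sqrt ((norm c)\<^sup>2 - (\<Sum>k\<in>F. (coord c k)\<^sup>2))" if "finite F" for F
  proof -
    have "(norm (restrict_ell2 F c - c))\<^sup>2 = (\<Sum>\<^sub>\<infinity>k\<in>UNIV - F. (coord c k)\<^sup>2)"
      unfolding norm_ell2_square by (rule infsum_cong_neutral) auto
    also have "\<dots> = (norm c)\<^sup>2 - (\<Sum>k\<in>F. (coord c k)\<^sup>2)"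
      using that unfolding norm_ell2_square by (subst infsum_Diff) (auto simp: coord_square_summable)
    finally show ?thesis
      by (metis abs_norm_cancel real_sqrt_abs)
  qed
  then have "\<forall>\<^sub>F F in finite_subsets_at_top UNIV.
      sqrt ((norm c)\<^sup>2 - (\<Sum>k\<in>F. (coord c k)\<^sup>2)) = norm (restrict_ell2 F c - c)"
    by (intro eventually_finite_subsets_at_top_weakI) simp
  ultimately have "((\<lambda>F. norm (restrict_ell2 F c - c)) \<longlongrightarrow> sqrt ((norm c)\<^sup>2 - (norm c)\<^sup>2))
      (finite_subsets_at_top UNIV)"
    by (rule Lim_transform_eventually)
  then show ?thesis
    by (simp add: tendsto_norm_zero_iff LIM_zero_iff)
qed

section \<open>Coercive operators\<close>

definition bounded_iso :: "('a::real_normed_vector \<Rightarrow> 'b::real_normed_vector) \<Rightarrow> bool" where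
  "bounded_iso T \<longleftrightarrow> bounded_linear T \<and>
    (\<exists>T'. bounded_linear T' \<and> (\<forall>x. T (T' x) = x) \<and> (\<forall>x. T' (T x) = x))"

lemma bounded_iso_bounded_linear: "bounded_iso T \<Longrightarrow> bounded_linear T"
  by (simp add: bounded_iso_def)

lemma bounded_iso_compose:
  assumes "bounded_iso S" "bounded_iso T"
  shows "bounded_iso (\<lambda>x. S (T x))"
proof -
  obtain S' T' where "bounded_linear S'" "\<forall>x. S (S' x) = x" "\<forall>x. S' (S x) = x"
    "bounded_linear T'" "\<forall>x. T (T' x) = x" "\<forall>x. T' (T x) = x"
    using assms unfolding bounded_iso_def by blast
  then show ?thesis
    using assms unfolding bounded_iso_def
    by (intro conjI exI[of _ "\<lambda>x. T' (S' x)"]) (auto intro: bounded_linear_compose)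
qed

lemma bounded_iso_bij: "bounded_iso T \<Longrightarrow> bij T"
  unfolding bounded_iso_def by (metis bijI')

lemma bounded_iso_bounds:
  assumes "bounded_iso T"
  obtains A B where "A > 0" "B > 0" "\<And>x. A * norm x \<le> norm (T x)" "\<And>x. norm (T x) \<le> B * norm x"
proof -
  obtain T' where T': "bounded_linear T'" "\<And>x. T' (T x) = x" and T: "bounded_linear T"
    using assms unfolding bounded_iso_def by blast
  obtain K where K: "K > 0" "\<And>x. norm (T' x) \<le> norm x * K"
    using bounded_linear.pos_bounded[OF T'(1)] by blast
  obtain B where B: "B > 0" "\<And>x. norm (T x) \<le> norm x * B"
    using bounded_linear.pos_bounded[OF T] by blast
  have "inverse K * norm x \<le> norm (T x)" for x
    using K(2)[of "T x"] K(1) by (simp add: T'(2) field_simps)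
  with K(1) B show ?thesis
    by (intro that[of "inverse K" B]) (auto simp: mult.commute)
qed

text \<open>Lax--Milgram: for small \<open>\<tau>\<close> the map \<open>x \<mapsto> x - \<tau> (T x - y)\<close> is a contraction.\<close>
lemma coercive_bounded_iso:
  fixes T :: "'a::{real_inner,complete_space} \<Rightarrow> 'a"
  assumes T: "bounded_linear T" and "\<delta> > 0" and coercive: "\<And>x. \<delta> * (norm x)\<^sup>2 \<le> T x \<bullet> x"
  shows "bounded_iso T"
proof -
  interpret T: bounded_linear T by fact
  obtain K0 where K0: "K0 > 0" "\<And>x. norm (T x) \<le> norm x * K0"
    using T.pos_bounded by blast
  \<comment> \<open>The maximum with \<delta> gives the square root in \<open>q\<close> a
    nonnegative argument, even on the zero space.\<close>
  define K where "K = max K0 \<delta>"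
  have K: "K > 0" "K \<ge> \<delta>" and TK: "norm (T x) \<le> K * norm x" for x
  proof -
    have "norm x * K0 \<le> norm x * K" by (intro mult_left_mono) (auto simp: K_def)
    then show "norm (T x) \<le> K * norm x" using K0(2)[of x] by (simp add: mult.commute)
  qed (use K0 in \<open>auto simp: K_def\<close>)
  \<comment> \<open>This value minimises the bound 1 - 2 \<tau> \<delta> + \<tau>^2 K^2 for the
    squared contraction factor; the minimum is the square of \<open>q\<close>.\<close>
  define \<tau> where "\<tau> = \<delta> / K\<^sup>2"
  have "\<tau> > 0" using \<open>\<delta> > 0\<close> K by (simp add: \<tau>_def)
  define q where "q = sqrt (1 - \<delta>\<^sup>2 / K\<^sup>2)"
  have "\<delta>\<^sup>2 / K\<^sup>2 \<le> 1" using K \<open>\<delta> > 0\<close> by (simp add: power_mono)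
  then have q: "0 \<le> q" "q < 1" "q\<^sup>2 = 1 - \<delta>\<^sup>2 / K\<^sup>2"
    using K \<open>\<delta> > 0\<close> by (auto simp: q_def)
  have contr: "norm (x - \<tau> *\<^sub>R T x) \<le> q * norm x" for x
  proof -
    have "(norm (T x))\<^sup>2 \<le> (K * norm x)\<^sup>2" using TK by (intro power_mono) auto
    then have "\<tau>\<^sup>2 * (norm (T x))\<^sup>2 \<le> \<tau>\<^sup>2 * (K * norm x)\<^sup>2"
      by (intro mult_left_mono) auto
    moreover have "\<tau> * (\<delta> * (norm x)\<^sup>2) \<le> \<tau> * (T x \<bullet> x)"
      using coercive \<open>\<tau> > 0\<close> by (intro mult_left_mono) auto
    moreover have "(norm (x - \<tau> *\<^sub>R T x))\<^sup>2 = (norm x)\<^sup>2 - 2 * (\<tau> * (T x \<bullet> x)) + \<tau>\<^sup>2 * (norm (T x))\<^sup>2"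
      unfolding power2_norm_eq_inner
      by (simp add: inner_diff_left inner_diff_right inner_commute power2_eq_square algebra_simps)
    ultimately have "(norm (x - \<tau> *\<^sub>R T x))\<^sup>2
        \<le> (norm x)\<^sup>2 - 2 * (\<tau> * (\<delta> * (norm x)\<^sup>2)) + \<tau>\<^sup>2 * (K * norm x)\<^sup>2"
      by linarith
    also have "\<dots> = (q * norm x)\<^sup>2"
      using K(1) by (simp add: \<tau>_def power_mult_distrib q(3)) (simp add: field_simps power2_eq_square)
    finally show ?thesis
      using q(1) by (simp add: abs_le_square_iff[symmetric])
  qed
  have ex: "\<exists>x. T x = y" for y
  proof -
    define f where "f x = x - \<tau> *\<^sub>R (T x - y)" for x
    have "dist (f x) (f z) \<le> q * dist x z" for x z
    proof -
      have "f x - f z = (x - z) - \<tau> *\<^sub>R T (x - z)"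
        by (simp add: f_def T.diff algebra_simps)
      then show ?thesis using contr[of "x - z"] by (simp add: dist_norm)
    qed
    then obtain x where "f x = x" using banach_fix_type[OF q(1,2), of f] by blast
    then show ?thesis using \<open>\<tau> > 0\<close> by (intro exI[of _ x]) (simp add: f_def)
  qed
  have lower: "\<delta> * norm x \<le> norm (T x)" for x
  proof (cases "x = 0")
    case False
    have "\<delta> * norm x * norm x \<le> T x \<bullet> x" using coercive[of x] by (simp add: power2_eq_square)
    also have "\<dots> \<le> norm (T x) * norm x" by (rule norm_cauchy_schwarz)
    finally show ?thesis using False by simp
  qed simp
  have inj: "x = z" if "T x = T z" for x z
    using lower[of "x - z"] \<open>\<delta> > 0\<close> that by (simp add: T.diff mult_le_0_iff)
  define T' where "T' y = (SOME x. T x = y)" for y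
  have T': "T (T' y) = y" for y
    unfolding T'_def by (rule someI_ex[OF ex])
  have "bounded_linear T'"
  proof (rule bounded_linear_intro[of _ "inverse \<delta>"])
    show "T' (x + y) = T' x + T' y" for x y by (rule inj) (simp add: T' T.add)
    show "T' (r *\<^sub>R x) = r *\<^sub>R T' x" for r x by (rule inj) (simp add: T' T.scaleR)
    show "norm (T' x) \<le> norm x * inverse \<delta>" for x
      using lower[of "T' x"] \<open>\<delta> > 0\<close> by (simp add: T' field_simps)
  qed
  moreover have "T' (T x) = x" for x by (rule inj) (simp add: T')
  ultimately show ?thesis
    using T T' unfolding bounded_iso_def by blast
qed

section \<open>Trigonometric polynomials and quadratic forms in shifts\<close>

lemma has_integral_cos_int:
  "((\<lambda>\<theta>. cos (of_int n * \<theta>)) has_integral (if n = 0 then 2 * pi else 0)) {- pi..pi}"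
proof (cases "n = 0")
  case True
  then show ?thesis using has_integral_const_real[of "1::real" "-pi" pi] by simp
next
  case False
  have "((\<lambda>\<theta>. cos (of_int n * \<theta>)) has_integral
      (sin (of_int n * pi) / of_int n - sin (of_int n * (- pi)) / of_int n)) {- pi..pi}"
    using False
    by (intro fundamental_theorem_of_calculus)
      (auto intro!: derivative_eq_intros simp: has_real_derivative_iff_has_vector_derivative[symmetric])
  then show ?thesis
    using False sin_npi_int[of n] by (simp add: mult.commute)
qed

lemma has_integral_cos_cos_int:
  "((\<lambda>\<theta>. cos (of_int a * \<theta>) * cos (of_int b * \<theta>)) has_integral
     pi * (of_bool (a = b) + of_bool (a = - b))) {- pi..pi}"
proof -
  have "((\<lambda>\<theta>. (cos (of_int (a - b) * \<theta>) + cos (of_int (a + b) * \<theta>)) / 2) has_integral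
     ((if a - b = 0 then 2 * pi else 0) + (if a + b = 0 then 2 * pi else 0)) / 2) {- pi..pi}"
    by (intro has_integral_divide has_integral_add has_integral_cos_int)
  moreover have "((if a - b = 0 then 2 * pi else 0) + (if a + b = 0 then 2 * pi else 0)) / 2
      = pi * (of_bool (a = b) + of_bool (a = - b))"
    by (auto simp: eq_neg_iff_add_eq_0)
  moreover have "cos (of_int a * \<theta>) * cos (of_int b * \<theta>)
      = (cos (of_int (a - b) * \<theta>) + cos (of_int (a + b) * \<theta>)) / 2" for \<theta> :: real
    by (simp add: cos_times_cos ring_distribs)
  ultimately show ?thesis
    by (simp only:)
qed

text \<open>The symbol is integrated over a period against the nonnegative weight |sum c_k
  e^(ik\<theta>)|^2; orthogonality turns each cosine into a form in the shifts. Cosines suffice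
  because a real quadratic form sees only the symmetric part of its operator.\<close>

lemma trig_polynomial_quadratic_form_finite:
  fixes c :: "int \<Rightarrow> real" and \<phi> :: "'i \<Rightarrow> int"
  assumes "finite I" "finite F"
    and symbol: "\<And>\<theta>. \<theta> \<in> {- pi..pi} \<Longrightarrow> \<delta> \<le> (\<Sum>i\<in>I. \<kappa> i * cos (of_int (\<phi> i) * \<theta>))"
  shows "\<delta> * (\<Sum>k\<in>F. (c k)\<^sup>2) \<le> (\<Sum>i\<in>I. \<kappa> i * (\<Sum>k\<in>F. \<Sum>l\<in>F. c k * c l * of_bool (\<phi> i = k - l)))"
proof -
  \<comment> \<open>The weight |sum c_k e^(ik\<theta>)|^2, expanded into frequencies for termwise
    integration.\<close>
  define w where "w \<theta> = (\<Sum>k\<in>F. \<Sum>l\<in>F. c k * c l * cos (of_int (k - l) * \<theta>))" for \<theta>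
  have w_eq: "w \<theta> = (\<Sum>k\<in>F. c k * cos (of_int k * \<theta>))\<^sup>2 + (\<Sum>k\<in>F. c k * sin (of_int k * \<theta>))\<^sup>2" for \<theta>
    unfolding w_def power2_eq_square sum_product
    by (simp add: sum.distrib[symmetric] left_diff_distrib cos_diff algebra_simps)
  then have w_nonneg: "w \<theta> \<ge> 0" for \<theta> by simp
  have w_int: "(w has_integral (\<Sum>k\<in>F. \<Sum>l\<in>F. c k * c l * (if k - l = 0 then 2 * pi else 0))) {- pi..pi}"
    unfolding w_def using \<open>finite F\<close>
    by (intro has_integral_sum has_integral_mult_right has_integral_cos_int)
  have diag: "(\<Sum>k\<in>F. \<Sum>l\<in>F. c k * c l * (if k - l = 0 then 2 * pi else 0)) = 2 * pi * (\<Sum>k\<in>F. (c k)\<^sup>2)"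
    using \<open>finite F\<close> by (simp add: sum_distrib_left power2_eq_square algebra_simps if_distrib cong: if_cong)
  have "((\<lambda>\<theta>. \<Sum>i\<in>I. \<Sum>k\<in>F. \<Sum>l\<in>F. (\<kappa> i * (c k * c l)) * (cos (of_int (\<phi> i) * \<theta>) * cos (of_int (k - l) * \<theta>)))
      has_integral (\<Sum>i\<in>I. \<Sum>k\<in>F. \<Sum>l\<in>F. (\<kappa> i * (c k * c l)) *
        (pi * (of_bool (\<phi> i = k - l) + of_bool (\<phi> i = - (k - l)))))) {- pi..pi}"
    using assms(1,2) by (intro has_integral_sum has_integral_mult_right has_integral_cos_cos_int)
  moreover have "(\<Sum>i\<in>I. \<Sum>k\<in>F. \<Sum>l\<in>F. (\<kappa> i * (c k * c l)) * (cos (of_int (\<phi> i) * \<theta>) * cos (of_int (k - l) * \<theta>)))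
      = (\<Sum>i\<in>I. \<kappa> i * cos (of_int (\<phi> i) * \<theta>)) * w \<theta>" for \<theta>
    unfolding w_def sum_distrib_right[of _ I] by (simp only: sum_distrib_left) (simp only: mult_ac)
  ultimately have prod_int: "((\<lambda>\<theta>. (\<Sum>i\<in>I. \<kappa> i * cos (of_int (\<phi> i) * \<theta>)) * w \<theta>)
      has_integral (\<Sum>i\<in>I. \<Sum>k\<in>F. \<Sum>l\<in>F. (\<kappa> i * (c k * c l)) *
        (pi * (of_bool (\<phi> i = k - l) + of_bool (\<phi> i = - (k - l)))))) {- pi..pi}"
    by simp
  \<comment> \<open>A cosine matches both k - l = \<phi> i and l - k = \<phi> i; swapping the
    summation variables shows that the two contributions agree.\<close>
  have sym: "(\<Sum>k\<in>F. \<Sum>l\<in>F. c k * c l * of_bool (\<phi> i = - (k - l)))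
      = (\<Sum>k\<in>F. \<Sum>l\<in>F. c k * c l * of_bool (\<phi> i = k - l))" for i
    by (subst sum.swap) (simp add: mult.commute)
  have "(\<Sum>k\<in>F. \<Sum>l\<in>F. (\<kappa> i * (c k * c l)) * (pi * (of_bool (\<phi> i = k - l) + of_bool (\<phi> i = - (k - l)))))
      = \<kappa> i * pi * ((\<Sum>k\<in>F. \<Sum>l\<in>F. c k * c l * of_bool (\<phi> i = k - l))
        + (\<Sum>k\<in>F. \<Sum>l\<in>F. c k * c l * of_bool (\<phi> i = - (k - l))))" for i
    by (simp only: sum_distrib_left sum.distrib[symmetric]) (simp only: ring_distribs mult_ac)
  then have total: "(\<Sum>i\<in>I. \<Sum>k\<in>F. \<Sum>l\<in>F. (\<kappa> i * (c k * c l)) *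
        (pi * (of_bool (\<phi> i = k - l) + of_bool (\<phi> i = - (k - l)))))
      = 2 * pi * (\<Sum>i\<in>I. \<kappa> i * (\<Sum>k\<in>F. \<Sum>l\<in>F. c k * c l * of_bool (\<phi> i = k - l)))"
    unfolding sym mult_2[symmetric] by (simp add: sum_distrib_left[of "2 * pi"]) (simp only: mult_ac)
  have "\<delta> * (2 * pi * (\<Sum>k\<in>F. (c k)\<^sup>2))
      \<le> 2 * pi * (\<Sum>i\<in>I. \<kappa> i * (\<Sum>k\<in>F. \<Sum>l\<in>F. c k * c l * of_bool (\<phi> i = k - l)))"
  proof (rule has_integral_le)
    show "((\<lambda>\<theta>. \<delta> * w \<theta>) has_integral \<delta> * (2 * pi * (\<Sum>k\<in>F. (c k)\<^sup>2))) {- pi..pi}"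
      using has_integral_mult_right[OF w_int, of \<delta>] unfolding diag .
  qed (use prod_int total symbol w_nonneg in \<open>auto intro!: mult_right_mono\<close>)
  then have "2 * pi * (\<delta> * (\<Sum>k\<in>F. (c k)\<^sup>2))
      \<le> 2 * pi * (\<Sum>i\<in>I. \<kappa> i * (\<Sum>k\<in>F. \<Sum>l\<in>F. c k * c l * of_bool (\<phi> i = k - l)))"
    by (simp only: mult_ac)
  then show ?thesis
    by (rule mult_left_le_imp_le) (simp add: pi_gt_zero)
qed

text \<open>Both sides are continuous in \<open>c\<close>, so the finite case for restrictions of
  \<open>c\<close> passes to the limit.\<close>

lemma trig_polynomial_quadratic_form:
  fixes \<phi> :: "'i \<Rightarrow> int"
  assumes "finite I"
    and symbol: "\<And>\<theta>. \<theta> \<in> {- pi..pi} \<Longrightarrow> \<delta> \<le> (\<Sum>i\<in>I. \<kappa> i * cos (of_int (\<phi> i) * \<theta>))"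
  shows "\<delta> * (norm c)\<^sup>2 \<le> (\<Sum>i\<in>I. \<kappa> i * (shift (\<phi> i) c \<bullet> c))"
proof (rule tendsto_le[OF finite_subsets_at_top_neq_bot])
  let ?c = "\<lambda>F. restrict_ell2 F c"
  show "((\<lambda>F. \<delta> * (norm (?c F))\<^sup>2) \<longlongrightarrow> \<delta> * (norm c)\<^sup>2) (finite_subsets_at_top UNIV)"
    by (intro tendsto_intros restrict_tendsto)
  show "((\<lambda>F. \<Sum>i\<in>I. \<kappa> i * (shift (\<phi> i) (?c F) \<bullet> ?c F)) \<longlongrightarrow> (\<Sum>i\<in>I. \<kappa> i * (shift (\<phi> i) c \<bullet> c)))
      (finite_subsets_at_top UNIV)"
    by (intro tendsto_intros restrict_tendsto bounded_linear.tendsto[OF bounded_linear_shift])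
  have "\<delta> * (norm (?c F))\<^sup>2 \<le> (\<Sum>i\<in>I. \<kappa> i * (shift (\<phi> i) (?c F) \<bullet> ?c F))" if "finite F" for F
  proof -
    have "shift j (?c F) \<bullet> ?c F = (\<Sum>k\<in>F. \<Sum>l\<in>F. coord c k * coord c l * of_bool (j = k - l))" for j
    proof -
      have "shift j (?c F) \<bullet> ?c F = (\<Sum>\<^sub>\<infinity>k\<in>F. coord (?c F) (k - j) * coord c k)"
        by (simp add: inner_ell2.rep_eq) (rule infsum_cong_neutral, auto)
      also have "\<dots> = (\<Sum>k\<in>F. coord (?c F) (k - j) * coord c k)"
        using that by simp
      also have "\<dots> = (\<Sum>k\<in>F. \<Sum>l\<in>F. coord c k * coord c l * of_bool (j = k - l))"
      proof (rule sum.cong[OF refl])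
        fix k
        have "F \<inter> {l. j = k - l} = (if k - j \<in> F then {k - j} else {})"
          by auto
        then show "coord (?c F) (k - j) * coord c k = (\<Sum>l\<in>F. coord c k * coord c l * of_bool (j = k - l))"
          using that by simp
      qed
      finally show ?thesis .
    qed
    moreover have "(norm (?c F))\<^sup>2 = (\<Sum>k\<in>F. (coord c k)\<^sup>2)"
    proof -
      have "(norm (?c F))\<^sup>2 = (\<Sum>\<^sub>\<infinity>k\<in>F. (coord c k)\<^sup>2)"
        unfolding norm_ell2_square by (rule infsum_cong_neutral) auto
      then show ?thesis using that by simp
    qed
    ultimately show ?thesis
      using trig_polynomial_quadratic_form_finite[OF \<open>finite I\<close> that symbol, of "coord c"] by simp
  qed
  then show "\<forall>\<^sub>F F in finite_subsets_at_top UNIV.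
      \<delta> * (norm (?c F))\<^sup>2 \<le> (\<Sum>i\<in>I. \<kappa> i * (shift (\<phi> i) (?c F) \<bullet> ?c F))"
    by (intro eventually_finite_subsets_at_top_weakI) simp
qed

section \<open>B-splines and their symbols\<close>

text \<open>Inductions on the order start from this hat function: the derivative formula for order m
  + 1 uses continuity of order m, which fails for m = 1.\<close>

lemma Bspline_2: "Bspline 2 x = max 0 (min x (2 - x))"
proof -
  have "Bspline 2 x = (LINT t|lborel. indicator {0..<1} (x - t) * indicator {0..<1} t)"
    by (simp add: numeral_2_eq_2)
  also have "\<dots> = (LINT t|lborel. indicator ({x - 1<..x} \<inter> {0..<1}) t)"
    by (intro Bochner_Integration.integral_cong) (auto simp: indicator_def)
  also have "\<dots> = measure lborel ({x - 1<..x} \<inter> {0..<1})"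
    by simp
  also have "{x - 1<..x} \<inter> {0..<1} = (if x < 0 then {} else if x < 1 then {0..x} else if x < 2 then {x - 1<..<1} else {})"
    by auto
  finally show ?thesis
    by (auto split: if_splits)
qed

text \<open>The substitution s = x - t turns convolution with the indicator into an integral over a
  moving window; closing the half-open window adds only a null set.\<close>

lemma Bspline_Suc_eq_integral:
  assumes "m > 0" "continuous_on UNIV (Bspline m)"
  shows "Bspline (Suc m) x = integral {x - 1..x} (Bspline m)"
proof -
  obtain k where m: "m = Suc k"
    using assms(1) gr0_conv_Suc by blast
  have "Bspline (Suc m) x = (LINT t|lborel. Bspline m (x - t) * indicator {0..<1} t)"
    by (simp add: m)
  also have "\<dots> = (LINT s|lborel. Bspline m s * indicator {0..<1} (x - s))"
    using lborel_integral_real_affine[of "-1" "\<lambda>t. Bspline m (x - t) * indicator {0..<1} t" x] by simp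
  also have "\<dots> = (LINT s|lborel. indicator {x - 1<..x} s *\<^sub>R Bspline m s)"
    by (intro Bochner_Integration.integral_cong) (auto simp: indicator_def)
  also have "\<dots> = (LINT s|lborel. indicator {x - 1..x} s *\<^sub>R Bspline m s)"
  proof (rule integral_cong_AE)
    have [measurable]: "Bspline m \<in> borel_measurable borel"
      using assms(2) by (rule borel_measurable_continuous_onI)
    show "(\<lambda>s. indicator {x - 1<..x} s *\<^sub>R Bspline m s) \<in> borel_measurable lborel"
      "(\<lambda>s. indicator {x - 1..x} s *\<^sub>R Bspline m s) \<in> borel_measurable lborel"
      by measurable
    have "AE s in lborel. s \<noteq> x - 1" by (rule AE_lborel_singleton)
    then show "AE s in lborel. indicator {x - 1<..x} s *\<^sub>R Bspline m s = indicator {x - 1..x} s *\<^sub>R Bspline m s"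
      by eventually_elim (auto simp: indicator_def)
  qed
  also have "\<dots> = integral {x - 1..x} (Bspline m)"
    using assms(2) borel_integrable_atLeastAtMost'[of "x - 1" x "Bspline m"]
      set_borel_integral_eq_integral(2)[of "{x - 1..x}" "Bspline m"]
    by (auto simp: set_lebesgue_integral_def intro: continuous_on_subset)
  finally show ?thesis .
qed

lemma window_integral_has_derivative:
  fixes f :: "real \<Rightarrow> real"
  assumes "continuous_on UNIV f"
  shows "((\<lambda>x. integral {x - 1..x} f) has_real_derivative f x - f (x - 1)) (at x)"
proof -
  \<comment> \<open>A base point to the left of every y - 1 with y near x, so that the window
    integral is a difference of two integrals from \<open>a\<close>.\<close>
  define a where "a = x - 3"
  have int: "f integrable_on {u..v}" for u v
    using assms by (intro integrable_continuous_real) (auto intro: continuous_on_subset)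
  have D: "((\<lambda>y. integral {a..y} f) has_real_derivative f y) (at y)" if "y \<in> {x - 2..x + 1}" for y
  proof -
    have "((\<lambda>y. integral {a..y} f) has_real_derivative f y) (at y within {a..x + 2})"
      using assms that by (intro integral_has_real_derivative) (auto simp: a_def intro: continuous_on_subset)
    then show ?thesis
      using that by (subst (asm) at_within_Icc_at) (auto simp: a_def)
  qed
  have "((\<lambda>y. integral {a..y} f - integral {a..y - 1} f) has_real_derivative f x - f (x - 1) * 1) (at x)"
    by (intro DERIV_diff D DERIV_chain2[where g = "\<lambda>y. y - 1", OF D])
      (auto intro!: derivative_eq_intros)
  moreover have "\<forall>\<^sub>F y in nhds x. integral {a..y} f - integral {a..y - 1} f = integral {y - 1..y} f"
  proof -
    have "\<forall>\<^sub>F y in nhds x. y \<in> {x - 1<..<x + 1}"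
      by (intro eventually_nhds_in_open) auto
    then show ?thesis
    proof eventually_elim
      case (elim y)
      then have "integral {a..y - 1} f + integral {y - 1..y} f = integral {a..y} f"
        by (intro Henstock_Kurzweil_Integration.integral_combine int) (auto simp: a_def)
      then show ?case by simp
    qed
  qed
  ultimately show ?thesis
    using DERIV_cong_ev[OF refl] by fastforce
qed

lemma continuous_on_Bspline: "m \<ge> 2 \<Longrightarrow> continuous_on UNIV (Bspline m)"
proof (induction m rule: nat_induct_at_least)
  case base
  show ?case by (simp add: Bspline_2 continuous_intros)
next
  case (Suc m)
  then have eq: "Bspline (Suc m) = (\<lambda>x. integral {x - 1..x} (Bspline m))"
    by (intro ext Bspline_Suc_eq_integral) auto
  show ?case
    unfolding eq continuous_on_eq_continuous_at[OF open_UNIV]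
    using window_integral_has_derivative[OF Suc.IH] DERIV_isCont by blast
qed

lemma Bspline_Suc_integral: "m \<ge> 2 \<Longrightarrow> Bspline (Suc m) x = integral {x - 1..x} (Bspline m)"
  by (intro Bspline_Suc_eq_integral continuous_on_Bspline) auto

lemma Bspline_Suc_has_derivative:
  assumes "m \<ge> 2"
  shows "(Bspline (Suc m) has_real_derivative Bspline m x - Bspline m (x - 1)) (at x)"
proof -
  have "Bspline (Suc m) = (\<lambda>x. integral {x - 1..x} (Bspline m))"
    using Bspline_Suc_integral[OF assms] by blast
  then show ?thesis
    using window_integral_has_derivative[OF continuous_on_Bspline[OF assms]] by simp
qed

lemma Bspline_integrable: "m \<ge> 2 \<Longrightarrow> Bspline m integrable_on {a..b}"
  by (intro integrable_continuous_real continuous_on_subset[OF continuous_on_Bspline]) auto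

lemma Bspline_bounds: "m \<ge> 2 \<Longrightarrow> Bspline m x \<in> {0..1}"
proof (induction m arbitrary: x rule: nat_induct_at_least)
  case base
  show ?case by (auto simp: Bspline_2)
next
  case (Suc m)
  have "integral {x - 1..x} (Bspline m) \<le> integral {x - 1..x} (\<lambda>_. 1)"
    using Suc by (intro integral_le Bspline_integrable) auto
  moreover have "0 \<le> integral {x - 1..x} (Bspline m)"
    using Suc by (intro integral_nonneg Bspline_integrable) auto
  ultimately show ?case
    using Suc.hyps by (simp add: Bspline_Suc_integral)
qed

lemma Bspline_eq_0: "m \<ge> 2 \<Longrightarrow> x \<le> 0 \<or> x \<ge> real m \<Longrightarrow> Bspline m x = 0"
proof (induction m arbitrary: x rule: nat_induct_at_least)
  case base
  then show ?case by (auto simp: Bspline_2)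
next
  case (Suc m)
  have "integral {x - 1..x} (Bspline m) = integral {x - 1..x} (\<lambda>_. 0)"
    using Suc by (intro integral_cong) auto
  then show ?case
    using Suc.hyps by (simp add: Bspline_Suc_integral)
qed

lemma Bspline_symmetric: "m \<ge> 2 \<Longrightarrow> Bspline m (real m - x) = Bspline m x"
proof (induction m arbitrary: x rule: nat_induct_at_least)
  case base
  show ?case by (auto simp: Bspline_2 min_def)
next
  case (Suc m)
  let ?B = "Bspline m"
  have "Bspline (Suc m) (real (Suc m) - x) = integral {real m - x..real m - (x - 1)} ?B"
    using Suc.hyps by (simp add: Bspline_Suc_integral algebra_simps)
  also have "\<dots> = integral {- x..- (x - 1)} (?B \<circ> (+) (real m))"
    using integral_shift_Icc_real[of "- x" "- (x - 1)" ?B "real m"] by (simp add: algebra_simps)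
  also have "\<dots> = integral {x - 1..x} (\<lambda>s. ?B (real m - s))"
    using Henstock_Kurzweil_Integration.integral_reflect_real[of x "x - 1" "\<lambda>s. ?B (real m - s)"]
    by (simp add: o_def)
  also have "\<dots> = Bspline (Suc m) x"
    using Suc by (simp add: Bspline_Suc_integral)
  finally show ?case .
qed

text \<open>If order m + 1 vanished identically, its derivative would make order m periodic with
  period 1, hence zero by its bounded support.\<close>

lemma Bspline_not_zero: "m \<ge> 2 \<Longrightarrow> \<exists>x. Bspline m x \<noteq> 0"
proof (induction m rule: nat_induct_at_least)
  case base
  show ?case by (rule exI[of _ 1]) (simp add: Bspline_2)
next
  case (Suc m)
  show ?case
  proof (rule ccontr)
    assume "\<nexists>x. Bspline (Suc m) x \<noteq> 0"
    then have "Bspline (Suc m) = (\<lambda>_. 0)" by auto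
    then have period: "Bspline m x = Bspline m (x - 1)" for x
      using Bspline_Suc_has_derivative[OF Suc.hyps, of x] DERIV_unique[OF _ DERIV_const[of 0]] by fastforce
    have "Bspline m x = Bspline m (x - real n)" for x n
    proof (induction n)
      case (Suc n)
      then show ?case using period[of "x - real n"] by (simp add: algebra_simps)
    qed simp
    then show False
      using Suc.IH by (metis Bspline_eq_0[OF Suc.hyps] diff_le_0_iff_le real_arch_simple)
  qed
qed

section \<open>The symbol of the spline samples\<close>

definition spline_symbol :: "nat \<Rightarrow> real \<Rightarrow> real \<Rightarrow> complex" where
  "spline_symbol m \<theta> x = (\<Sum>j | Bspline m (x + real m / 2 + of_int j) \<noteq> 0.
     of_real (Bspline m (x + real m / 2 + of_int j)) * cis (of_int j * \<theta>))"

lemma Bspline_centered_eq_0: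
  assumes "m \<ge> 2" "j \<notin> {- int (m + n)..int (m + n)}" "\<bar>x\<bar> \<le> real n"
  shows "Bspline m (x + real m / 2 + of_int j) = 0"
proof (rule Bspline_eq_0[OF assms(1)])
  have "j \<le> - int (m + n) - 1 \<or> j \<ge> int (m + n) + 1" using assms(2) by auto
  then have "real_of_int j \<le> - (real m + real n) - 1 \<or> real_of_int j \<ge> real m + real n + 1"
    by linarith
  then show "x + real m / 2 + of_int j \<le> 0 \<or> x + real m / 2 + of_int j \<ge> real m"
    using assms(3) by auto
qed

lemma finite_Bspline_support: "m \<ge> 2 \<Longrightarrow> finite {j. Bspline m (x + real m / 2 + of_int j) \<noteq> 0}"
proof -
  assume m: "m \<ge> 2"
  obtain n where "\<bar>x\<bar> \<le> real n" using real_arch_simple by blast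
  then have "{j. Bspline m (x + real m / 2 + of_int j) \<noteq> 0} \<subseteq> {- int (m + n)..int (m + n)}"
    using Bspline_centered_eq_0[OF m] by blast
  then show ?thesis by (rule finite_subset) simp
qed

lemma spline_symbol_eq_sum:
  assumes "finite J" "\<And>j. j \<notin> J \<Longrightarrow> Bspline m (x + real m / 2 + of_int j) = 0"
  shows "spline_symbol m \<theta> x =
    (\<Sum>j\<in>J. of_real (Bspline m (x + real m / 2 + of_int j)) * cis (of_int j * \<theta>))"
  unfolding spline_symbol_def using assms by (intro sum.mono_neutral_left) auto

lemma spline_symbol_eq_sum_Icc:
  assumes "m \<ge> 2" "\<bar>x\<bar> \<le> real n"
  shows "spline_symbol m \<theta> x = (\<Sum>j = - int (m + n)..int (m + n).
    of_real (Bspline m (x + real m / 2 + of_int j)) * cis (of_int j * \<theta>))"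
  using Bspline_centered_eq_0[OF assms(1) _ assms(2)] by (intro spline_symbol_eq_sum) auto

lemma spline_symbol_add_1: "spline_symbol m \<theta> (x + 1) = cis (- \<theta>) * spline_symbol m \<theta> x"
  unfolding spline_symbol_def sum_distrib_left
  by (rule sum.reindex_bij_witness[of _ "\<lambda>j. j - 1" "\<lambda>j. j + 1"])
    (auto simp: algebra_simps cis_mult)

text \<open>Centring at m/2 turns the symmetry of \<open>Bspline\<close> into the substitution of -j
  for j, which conjugates the exponentials. Together with \<open>spline_symbol_add_1\<close> this
  relates the values at 1/2 + t and 1/2 - t.\<close>

lemma spline_symbol_minus:
  assumes "m \<ge> 2"
  shows "spline_symbol m \<theta> (- x) = cnj (spline_symbol m \<theta> x)"
proof -
  have sym: "Bspline m (- x + real m / 2 + of_int j) = Bspline m (x + real m / 2 - of_int j)" for j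
    using Bspline_symmetric[OF assms, of "x + real m / 2 - of_int j"] by (simp add: field_simps)
  show ?thesis
    unfolding spline_symbol_def cnj_sum
    by (rule sum.reindex_bij_witness[of _ uminus uminus]) (simp_all only: sym mem_Collect_eq, simp_all add: cis_cnj)
qed

lemma spline_symbol_minus_angle: "spline_symbol m (- \<theta>) x = cnj (spline_symbol m \<theta> x)"
  by (simp add: spline_symbol_def cis_cnj)

text \<open>The derivative of a B-spline is a difference of values one step apart; reindexing the
  second sum produces the factor 1 - cis \<theta>. The shift by 1/2 comes from moving the centre
  from (m + 1)/2 to m/2.\<close>

lemma spline_symbol_has_derivative:
  assumes "m \<ge> 2"
  shows "(spline_symbol (Suc m) \<theta> has_vector_derivative
    (1 - cis \<theta>) * spline_symbol m \<theta> (x + 1/2)) (at x)"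
proof -
  \<comment> \<open>The margin 2 keeps the index window valid for all y within 1 of x and for x +
    1/2.\<close>
  obtain n where n: "\<bar>x\<bar> + 2 \<le> real n" using real_arch_simple by blast
  define J where "J = {- int (Suc m + n)..int (Suc m + n)}"
  define D where "D = (\<Sum>j\<in>J. of_real (Bspline m (x + real (Suc m) / 2 + of_int j)
      - Bspline m (x + real (Suc m) / 2 + of_int j - 1)) * cis (of_int j * \<theta>))"
  have "((\<lambda>y. \<Sum>j\<in>J. of_real (Bspline (Suc m) (y + real (Suc m) / 2 + of_int j)) * cis (of_int j * \<theta>))
      has_vector_derivative D) (at x)"
    unfolding D_def
  proof (intro has_vector_derivative_sum has_vector_derivative_mult_left has_vector_derivative_of_real)
    fix j
    show "((\<lambda>y. Bspline (Suc m) (y + real (Suc m) / 2 + of_int j)) has_real_derivative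
        Bspline m (x + real (Suc m) / 2 + of_int j) - Bspline m (x + real (Suc m) / 2 + of_int j - 1)) (at x)"
      by (rule DERIV_chain2[OF Bspline_Suc_has_derivative[OF assms], THEN DERIV_cong])
        (auto intro!: derivative_eq_intros)
  qed
  then have "(spline_symbol (Suc m) \<theta> has_vector_derivative D) (at x)"
  proof (rule has_vector_derivative_transform_within_open[where S = "{x - 1<..<x + 1}"])
    fix y assume "y \<in> {x - 1<..<x + 1}"
    then have "\<bar>y\<bar> \<le> real n" using n by auto
    then show "(\<Sum>j\<in>J. of_real (Bspline (Suc m) (y + real (Suc m) / 2 + of_int j)) * cis (of_int j * \<theta>))
        = spline_symbol (Suc m) \<theta> y"
      using assms unfolding J_def by (intro spline_symbol_eq_sum_Icc[symmetric]) auto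
  qed auto
  moreover have "D = (1 - cis \<theta>) * spline_symbol m \<theta> (x + 1/2)"
  proof -
    let ?b = "\<lambda>j. Bspline m (x + 1/2 + real m / 2 + of_int j)"
    let ?J' = "{- int (Suc m + n) - 1..int (Suc m + n) - 1}"
    have vanish: "?b j = 0" if "j \<notin> {- int (m + n)..int (m + n)}" for j
      using n that by (intro Bspline_centered_eq_0[where n = n] assms) auto
    have "D = (\<Sum>j\<in>J. of_real (?b j) * cis (of_int j * \<theta>)) - (\<Sum>j\<in>J. of_real (?b (j - 1)) * cis (of_int j * \<theta>))"
      unfolding D_def sum_subtractf[symmetric]
      by (intro sum.cong refl) (simp add: add_divide_distrib algebra_simps)
    also have "(\<Sum>j\<in>J. of_real (?b j) * cis (of_int j * \<theta>)) = spline_symbol m \<theta> (x + 1/2)"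
      by (intro spline_symbol_eq_sum[symmetric] vanish) (auto simp: J_def)
    also have "(\<Sum>j\<in>J. of_real (?b (j - 1)) * cis (of_int j * \<theta>))
        = (\<Sum>j\<in>?J'. cis \<theta> * (of_real (?b j) * cis (of_int j * \<theta>)))"
      unfolding J_def
      by (rule sum.reindex_bij_witness[of _ "\<lambda>j. j + 1" "\<lambda>j. j - 1"])
        (auto simp: cis_mult algebra_simps)
    also have "\<dots> = cis \<theta> * spline_symbol m \<theta> (x + 1/2)"
      unfolding sum_distrib_left[symmetric]
      by (intro arg_cong2[of _ _ _ _ "(*)"] refl spline_symbol_eq_sum[symmetric] vanish) auto
    finally show ?thesis by (simp add: algebra_simps)
  qed
  ultimately show ?thesis by simp
qed

text \<open>The symbol stays in the sector with arguments between \<open>- \<theta>/2\<close> and \<open>0\<close>: by the derivative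
  formula the sector condition for order \<open>m\<close> makes its imaginary part, its real part and
  \<open>Im (cis (\<theta>/2) * spline_symbol (Suc m) \<theta> x)\<close> decrease, and symmetry fixes the boundary values.\<close>
lemma spline_symbol_sector:
  assumes "m \<ge> 2" "0 < \<theta>" "\<theta> \<le> pi" "0 \<le> x" "x < 1/2"
  shows "Re (spline_symbol m \<theta> x) > 0 \<and> Im (spline_symbol m \<theta> x) \<le> 0
    \<and> Im (cis (\<theta>/2) * spline_symbol m \<theta> x) > 0"
  using assms(1,4,5)
proof (induction m arbitrary: x rule: nat_induct_at_least)
  case base
  \<comment> \<open>Only the arguments x and x + 1 can lie inside the support of the hat
    function.\<close>
  have "Bspline 2 (x + real 2 / 2 + of_int j) = 0" if "j \<notin> {-1, 0}" for j
  proof (rule Bspline_eq_0)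
    have "j \<le> -2 \<or> j \<ge> 1" using that by auto
    then have "real_of_int j \<le> -2 \<or> real_of_int j \<ge> 1" by linarith
    then show "x + real 2 / 2 + of_int j \<le> 0 \<or> x + real 2 / 2 + of_int j \<ge> real 2"
      using base by auto
  qed simp
  then have "spline_symbol 2 \<theta> x =
      (\<Sum>j\<in>{-1, 0}. of_real (Bspline 2 (x + real 2 / 2 + of_int j)) * cis (of_int j * \<theta>))"
    by (intro spline_symbol_eq_sum) auto
  then have eq: "spline_symbol 2 \<theta> x = of_real x * cis (- \<theta>) + of_real (1 - x)"
    using base by (simp add: Bspline_2)
  have "x * cos \<theta> \<ge> - x" using mult_left_mono[of "-1" "cos \<theta>" x] base by simp
  moreover have "x * sin \<theta> \<ge> 0" using assms base sin_ge_zero[of \<theta>] by simp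
  moreover
  have wF: "cis (\<theta>/2) * spline_symbol 2 \<theta> x = of_real x * cis (- (\<theta>/2)) + of_real (1 - x) * cis (\<theta>/2)"
    by (simp add: eq cis_mult distrib_left mult.left_commute mult.commute)
  have "(1 - 2 * x) * sin (\<theta>/2) > 0"
    using assms base sin_gt_zero[of "\<theta>/2"] by simp
  then have "Im (cis (\<theta>/2) * spline_symbol 2 \<theta> x) > 0"
    unfolding wF by (simp add: algebra_simps)
  ultimately show ?case
    using base by (simp add: eq)
next
  case (Suc m)
  define F where "F = spline_symbol (Suc m) \<theta>"
  define G where "G = spline_symbol m \<theta>"
  define w where "w = cis (\<theta>/2)"
  define s where "s = sin (\<theta>/2)"
  have s: "s > 0" using assms sin_gt_zero[of "\<theta>/2"] by (simp add: s_def)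
  have cw: "cos (\<theta>/2) \<ge> 0" using assms by (intro cos_ge_zero) auto
  have G: "Re (G y) > 0" "Im (G y) \<le> 0" "Im (w * G y) > 0" if "0 \<le> y" "y < 1/2" for y
    using Suc.IH[OF that] by (auto simp: G_def w_def)
  have wG: "Re (w * G y) \<ge> 0" if "0 \<le> y" "y < 1/2" for y
  proof -
    have "Re (G y) * cos (\<theta>/2) \<ge> 0" "Im (G y) * sin (\<theta>/2) \<le> 0"
      using G[OF that] cw s by (auto simp: s_def mult_nonpos_nonneg)
    then show ?thesis by (simp add: w_def mult.commute)
  qed
  have cisw: "cis \<theta> = w * w" by (simp add: w_def cis_mult)
  have cnjw: "cnj w * w = 1" "cis (- \<theta>) = cnj w * cnj w"
    by (auto simp: w_def cis_cnj cis_mult)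
  have ww: "cnj w - w = - 2 * \<i> * of_real s"
    by (simp add: w_def s_def complex_eq_iff)
  \<comment> \<open>Shift and reflection express \<open>G (t + 1/2)\<close> through
    \<open>G (1/2 - t)\<close>, and for 0 < t < 1/2 that point lies in the range of the induction
    hypothesis. As \<open>cnj w - w\<close> is purely imaginary, real and imaginary parts trade
    places.\<close>
  have D: "(F has_vector_derivative - 2 * \<i> * of_real s * cnj (w * G (1/2 - t))) (at t)" for t
  proof -
    have "G (t + 1/2) = cnj w * cnj w * cnj (G (1/2 - t))"
      using spline_symbol_add_1[of m \<theta> "- (1/2 - t)"] spline_symbol_minus[OF Suc.hyps, of \<theta> "1/2 - t"]
      by (simp add: G_def cnjw add.commute)
    then have "(1 - cis \<theta>) * G (t + 1/2) = (cnj w * (cnj w * (1 - w * w))) * cnj (G (1/2 - t))"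
      by (simp add: cisw mult_ac)
    also have "cnj w * (1 - w * w) = cnj w - w"
      using cnjw(1) by (simp add: algebra_simps)
    finally show ?thesis
      using spline_symbol_has_derivative[OF Suc.hyps, of \<theta> t] by (simp add: ww F_def G_def mult_ac)
  qed
  have wD: "((\<lambda>t. w * F t) has_vector_derivative - 2 * \<i> * of_real s * cnj (G (1/2 - t))) (at t)" for t
  proof -
    have "w * (- 2 * \<i> * of_real s * cnj (w * G (1/2 - t))) = (cnj w * w) * (- 2 * \<i> * of_real s * cnj (G (1/2 - t)))"
      by (simp add: mult_ac)
    then show ?thesis
      using has_vector_derivative_mult_right[OF D[of t], of w] by (simp only: cnjw(1) mult_1)
  qed
  have ReIm: "Re (- 2 * \<i> * of_real s * cnj u) = - 2 * s * Im u"
    "Im (- 2 * \<i> * of_real s * cnj u) = - 2 * s * Re u" for u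
    by simp_all
  have DRe: "((\<lambda>t. Re (F t)) has_real_derivative - 2 * s * Im (w * G (1/2 - t))) (at t)" for t
    using bounded_linear.has_vector_derivative[OF bounded_linear_Re D[of t]]
    by (simp only: ReIm has_real_derivative_iff_has_vector_derivative)
  have DIm: "((\<lambda>t. Im (F t)) has_real_derivative - 2 * s * Re (w * G (1/2 - t))) (at t)" for t
    using bounded_linear.has_vector_derivative[OF bounded_linear_Im D[of t]]
    by (simp only: ReIm has_real_derivative_iff_has_vector_derivative)
  have DwIm: "((\<lambda>t. Im (w * F t)) has_real_derivative - 2 * s * Re (G (1/2 - t))) (at t)" for t
    using bounded_linear.has_vector_derivative[OF bounded_linear_Im wD[of t]]
    by (simp only: ReIm has_real_derivative_iff_has_vector_derivative)
  \<comment> \<open>Shift and reflection both relate 1/2 to -1/2, which makes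
    \<open>w * F (1/2)\<close> equal to its conjugate.\<close>
  have half: "Im (w * F (1/2)) = 0"
  proof -
    have "F (1/2) = cnj w * cnj w * cnj (F (1/2))"
      using spline_symbol_add_1[of "Suc m" \<theta> "- (1/2)"] spline_symbol_minus[of "Suc m" \<theta> "1/2"] Suc.hyps
      by (simp add: F_def cnjw)
    then have "w * F (1/2) = (cnj w * w) * (cnj w * cnj (F (1/2)))"
      by (metis mult.assoc mult.commute)
    then have "w * F (1/2) = cnj (w * F (1/2))" by (simp add: cnjw)
    then show ?thesis by (metis complex_cnj_cancel_iff complex_is_Real_iff Reals_cnj_iff)
  qed
  have F0: "Im (F 0) = 0"
    using spline_symbol_minus[of "Suc m" \<theta> 0] Suc.hyps by (simp add: F_def complex_eq_iff)
  have ImF: "Im (F y) \<le> 0" if "0 \<le> y" "y \<le> 1/2" for y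
  proof -
    have "Im (F y) \<le> Im (F 0)"
    proof (rule DERIV_nonpos_imp_decreasing_open[OF that(1)])
      fix t assume "0 < t" "t < y"
      then have "- 2 * s * Re (w * G (1/2 - t)) \<le> 0"
        using wG[of "1/2 - t"] s that by (simp del: times_complex.sel)
      then show "\<exists>d. ((\<lambda>t. Im (F t)) has_real_derivative d) (at t) \<and> d \<le> 0"
        using DIm[of t] by blast
    qed (auto intro!: continuous_at_imp_continuous_on DERIV_isCont[OF DIm])
    then show ?thesis by (simp add: F0)
  qed
  have dec: "f (1/2) < f x"
    if "\<And>t. (f has_real_derivative - 2 * s * g t) (at t)" "\<And>t. 0 < t \<Longrightarrow> t < 1/2 \<Longrightarrow> g t > 0" for f g :: "real \<Rightarrow> real"
  proof (rule DERIV_neg_imp_decreasing_open[OF \<open>x < 1/2\<close>])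
    fix t assume t: "x < t" "t < 1/2"
    have "- 2 * s * g t < 0"
      using that(2)[of t] s t \<open>0 \<le> x\<close> by simp
    then show "\<exists>d. (f has_real_derivative d) (at t) \<and> d < 0"
      using that(1)[of t] by blast
  qed (auto intro!: continuous_at_imp_continuous_on DERIV_isCont[OF that(1)])
  have "Im (w * F x) > 0"
  proof -
    have "Im (w * F (1/2)) < Im (w * F x)" by (rule dec[OF DwIm]) (simp add: G(1))
    then show ?thesis by (simp only: half)
  qed
  \<comment> \<open>As \<open>F (1/2)\<close> is a real multiple \<open>R\<close> of
    \<open>cnj w\<close>, the known sign of its imaginary part decides the sign of
    \<open>R\<close>.\<close>
  have "Re (F (1/2)) \<ge> 0"
  proof -
    define R where "R = Re (w * F (1/2))"
    have "w * F (1/2) = of_real R" using half by (simp add: R_def complex_eq_iff)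
    then have "(cnj w * w) * F (1/2) = cnj w * of_real R" by (metis mult.assoc)
    then have "F (1/2) = cnj w * of_real R" unfolding cnjw(1) by simp
    then have "Im (F (1/2)) = - R * s" "Re (F (1/2)) = R * cos (\<theta>/2)"
      by (auto simp: w_def s_def)
    then show ?thesis
      using ImF[of "1/2"] s cw by (auto simp: zero_le_mult_iff)
  qed
  moreover have "Re (F x) > 0"
  proof -
    have "Re (F (1/2)) < Re (F x)"
      by (rule dec[OF DRe]) (simp add: G(3) del: times_complex.sel)
    then show ?thesis using \<open>Re (F (1/2)) \<ge> 0\<close> by simp
  qed
  ultimately show ?case
    using ImF[of x] Suc.prems \<open>Im (w * F x) > 0\<close> by (simp add: F_def w_def)
qed

text \<open>At angle 0 the factor 1 - cis \<theta> vanishes, so the symbol is constant in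
  \<open>x\<close> and can be evaluated where some spline value is positive. The derivative formula
  requires order at least 3 here.\<close>

lemma Re_spline_symbol_0_pos:
  assumes "m \<ge> 3"
  shows "Re (spline_symbol m 0 x) > 0"
proof -
  obtain k where k: "m = Suc k" "k \<ge> 2"
    using assms by (cases m) auto
  obtain y where y: "Bspline m y \<noteq> 0" using Bspline_not_zero[of m] assms by auto
  have "\<exists>c. \<forall>x. spline_symbol m 0 x = c"
    using spline_symbol_has_derivative[OF k(2), of 0] k(1)
    by (intro has_derivative_zero_constant[of UNIV, simplified]) (auto simp: has_vector_derivative_def)
  then have "spline_symbol m 0 x = spline_symbol m 0 (y - real m / 2)" by metis
  moreover have "Re (spline_symbol m 0 (y - real m / 2)) > 0"
    unfolding spline_symbol_def Re_sum
    using y finite_Bspline_support[of m "y - real m / 2"] Bspline_bounds[of m] assms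
    by (intro sum_pos2[of _ 0]) (auto simp: order_less_le)
  ultimately show ?thesis by simp
qed

text \<open>Conjugation symmetries in \<theta> and \<open>x\<close> reduce to the nonnegative case.
  The sector lemma covers positive angles; angle 0 is separate, with order 2 settled by the term j =
  0.\<close>

lemma Re_spline_symbol_pos:
  assumes "m \<ge> 2" "\<bar>\<theta>\<bar> \<le> pi" "\<bar>x\<bar> < 1/2"
  shows "Re (spline_symbol m \<theta> x) > 0"
proof -
  have nonneg: "Re (spline_symbol m \<theta> x) > 0" if "0 \<le> \<theta>" "\<theta> \<le> pi" "0 \<le> x" "x < 1/2" for \<theta> x
  proof (cases "\<theta> = 0")
    case False
    then show ?thesis using spline_symbol_sector[of m \<theta> x] that assms(1) by auto
  next
    case True
    show ?thesis
    proof (cases "m = 2")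
      case True
      have b0: "Bspline 2 (x + real 2 / 2 + of_int 0) > 0"
        using that by (simp add: Bspline_2)
      show ?thesis
        unfolding spline_symbol_def Re_sum \<open>\<theta> = 0\<close> True
        using b0 finite_Bspline_support[of 2 x] Bspline_bounds[of 2]
        by (intro sum_pos2[of _ 0]) auto
    qed (use True Re_spline_symbol_0_pos[of m x] assms(1) in auto)
  qed
  have "Re (spline_symbol m \<theta> x) = Re (spline_symbol m \<bar>\<theta>\<bar> \<bar>x\<bar>)"
    using spline_symbol_minus[OF assms(1)] by (auto simp: abs_if spline_symbol_minus_angle)
  then show ?thesis using nonneg[of "\<bar>\<theta>\<bar>" "\<bar>x\<bar>"] assms by simp
qed

lemma Im_spline_symbol_0: "m \<ge> 2 \<Longrightarrow> Im (spline_symbol m \<theta> 0) = 0"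
  using spline_symbol_minus[of m \<theta> 0] by (simp add: complex_eq_iff)

text \<open>All sines vanish at multiples of \<pi>, so the value is real, while shift and reflection
  make it the negative of its conjugate.\<close>

lemma spline_symbol_half: "m \<ge> 2 \<Longrightarrow> spline_symbol m pi (1/2) = 0"
proof -
  assume m: "m \<ge> 2"
  have real: "Im (spline_symbol m pi (1/2)) = 0"
  proof -
    have "sin (of_int j * pi) = 0" for j using sin_npi_int[of j] by (simp add: mult.commute)
    then show ?thesis unfolding spline_symbol_def Im_sum by simp
  qed
  have "spline_symbol m pi (1/2) = - cnj (spline_symbol m pi (1/2))"
    using spline_symbol_add_1[of m pi "- (1/2)"] spline_symbol_minus[OF m, of pi "1/2"]
    by (simp add: complex_eq_iff)
  then show ?thesis using real by (simp add: complex_eq_iff)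
qed

text \<open>The index window no longer depends on \<open>x\<close>; joint continuity and the match
  with \<open>sample_op\<close> rest on this.\<close>

lemma Re_spline_symbol_eq_sum:
  assumes "m \<ge> 2" "\<bar>x\<bar> \<le> 1"
  shows "Re (spline_symbol m \<theta> x) =
    (\<Sum>j = - int (m + 1)..int (m + 1). Bspline m (x + real m / 2 + of_int j) * cos (of_int j * \<theta>))"
  by (subst spline_symbol_eq_sum_Icc[of m x 1]) (use assms in auto)

lemma Im_spline_symbol_eq_sum:
  assumes "m \<ge> 2" "\<bar>x\<bar> \<le> 1"
  shows "Im (spline_symbol m \<theta> x) =
    (\<Sum>j = - int (m + 1)..int (m + 1). Bspline m (x + real m / 2 + of_int j) * sin (of_int j * \<theta>))"
  by (subst spline_symbol_eq_sum_Icc[of m x 1]) (use assms in auto)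

text \<open>Positivity becomes uniform by joint continuity on a compact rectangle of angles and
  offsets.\<close>

lemma Re_spline_symbol_bounded_below:
  assumes "m \<ge> 2" "0 \<le> \<rho>" "\<rho> < 1/2"
  obtains \<delta> where "\<delta> > 0" "\<And>\<theta> x. \<bar>\<theta>\<bar> \<le> pi \<Longrightarrow> \<bar>x\<bar> \<le> \<rho> \<Longrightarrow> \<delta> \<le> Re (spline_symbol m \<theta> x)"
proof -
  define f where "f p = (\<Sum>j = - int (m + 1)..int (m + 1).
      Bspline m (snd p + real m / 2 + of_int j) * cos (of_int j * fst p))" for p
  have f: "Re (spline_symbol m \<theta> x) = f (\<theta>, x)" if "\<bar>x\<bar> \<le> \<rho>" for \<theta> x
    using Re_spline_symbol_eq_sum[of m x \<theta>] assms that by (simp add: f_def)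
  define K where "K = {- pi..pi} \<times> {- \<rho>..\<rho>}"
  have "compact K" "K \<noteq> {}" using assms by (auto simp: K_def intro: compact_Times)
  moreover have "continuous_on K f"
    unfolding f_def
    by (intro continuous_intros continuous_on_compose2[OF continuous_on_Bspline[OF assms(1)]]) auto
  ultimately obtain p where p: "p \<in> K" "\<And>q. q \<in> K \<Longrightarrow> f p \<le> f q"
    using continuous_attains_inf[of K f] by blast
  show ?thesis
  proof (rule that[of "f p"])
    show "f p > 0"
      using p(1) f[of "snd p" "fst p"] Re_spline_symbol_pos[of m "fst p" "snd p"] assms
      by (auto simp: K_def)
    show "f p \<le> Re (spline_symbol m \<theta> x)" if "\<bar>\<theta>\<bar> \<le> pi" "\<bar>x\<bar> \<le> \<rho>" for \<theta> x
      using p(2)[of "(\<theta>, x)"] f[of x \<theta>] that by (simp add: K_def abs_le_iff)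
  qed
qed

section \<open>Sampling operators\<close>

text \<open>With \<open>P\<close>, \<open>Q\<close> the restrictions to \<open>U\<close> and its complement and \<open>G = B \<circ> A\<^sup>-\<^sup>1\<close>, the operator
  factors as \<open>P A + Q B = (I + Q G P) (P + Q G Q) A\<close>: the first factor is unipotent and the other two
  are coercive.\<close>
lemma paired_operator_bounded_iso:
  fixes A B :: "ell2 \<Rightarrow> ell2"
  assumes A: "bounded_linear A" and B: "bounded_linear B" and "\<delta> > 0"
    and A_coercive: "\<And>c. \<delta> * (norm c)\<^sup>2 \<le> A c \<bullet> c"
    and BA_coercive: "\<And>c. \<delta> * (norm c)\<^sup>2 \<le> B c \<bullet> A c"
  shows "bounded_iso (\<lambda>c. restrict_ell2 U (A c) + restrict_ell2 (- U) (B c))"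
proof -
  let ?P = "restrict_ell2 U" and ?Q = "restrict_ell2 (- U)"
  have A_iso: "bounded_iso A"
    by (rule coercive_bounded_iso[OF A \<open>\<delta> > 0\<close> A_coercive])
  then obtain A' where A': "bounded_linear A'" "\<And>e. A (A' e) = e" "\<And>c. A' (A c) = c"
    unfolding bounded_iso_def by blast
  define G where "G e = B (A' e)" for e
  have G: "bounded_linear G"
    unfolding G_def by (rule bounded_linear_compose[OF B A'(1)])
  interpret P: bounded_linear ?P by (rule bounded_linear_restrict)
  interpret Q: bounded_linear ?Q by (rule bounded_linear_restrict)
  interpret G: bounded_linear G by (rule G)
  have PQ: "?P (?P e) = ?P e" "?Q (?Q e) = ?Q e" "?P (?Q e) = 0" "?Q (?P e) = 0" "e = ?P e + ?Q e" for e
    by (auto intro!: ell2_eqI)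
  obtain K where K: "K > 0" "\<And>c. norm (A c) \<le> norm c * K"
    using bounded_linear.pos_bounded[OF A] by blast
  \<comment> \<open>Coercivity of \<open>B\<close> against \<open>A\<close> becomes coercivity of
    \<open>G\<close> at e = \<open>A c\<close>; the factor K^2 pays for passing from the norm of
    \<open>A' e\<close> to that of \<open>e\<close>.\<close>
  define \<epsilon> where "\<epsilon> = \<delta> / K\<^sup>2"
  have "\<epsilon> > 0" using \<open>\<delta> > 0\<close> K by (simp add: \<epsilon>_def)
  have G_coercive: "\<epsilon> * (norm e)\<^sup>2 \<le> G e \<bullet> e" for e
  proof -
    have "(norm e)\<^sup>2 \<le> (norm (A' e) * K)\<^sup>2"
      using K(2)[of "A' e"] by (intro power_mono) (auto simp: A')
    then have "\<epsilon> * (norm e)\<^sup>2 \<le> \<epsilon> * (norm (A' e) * K)\<^sup>2"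
      using \<open>\<epsilon> > 0\<close> by (intro mult_left_mono) auto
    also have "\<dots> = \<delta> * (norm (A' e))\<^sup>2"
      using K(1) by (simp add: \<epsilon>_def power_mult_distrib)
    also have "\<dots> \<le> G e \<bullet> e"
      using BA_coercive[of "A' e"] by (simp add: G_def A')
    finally show ?thesis .
  qed
  define S where "S e = ?P e + ?Q (G (?Q e))" for e
  have "bounded_iso S"
  proof (rule coercive_bounded_iso)
    show "bounded_linear S"
      unfolding S_def
      by (intro bounded_linear_add bounded_linear_restrict
          bounded_linear_compose[OF bounded_linear_restrict bounded_linear_compose[OF G bounded_linear_restrict]])
    show "min 1 \<epsilon> > 0" using \<open>\<epsilon> > 0\<close> by simp
    show "min 1 \<epsilon> * (norm e)\<^sup>2 \<le> S e \<bullet> e" for e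
    proof -
      have "e \<bullet> e = ?P e \<bullet> e + ?Q e \<bullet> e"
        using PQ(5)[of e] by (metis inner_add_left)
      then have e: "(norm e)\<^sup>2 = (norm (?P e))\<^sup>2 + (norm (?Q e))\<^sup>2"
        by (simp add: power2_norm_eq_inner inner_restrict[of _ e e])
      have "S e \<bullet> e = (norm (?P e))\<^sup>2 + ?Q (G (?Q e)) \<bullet> ?Q e"
        by (simp add: S_def inner_add_left power2_norm_eq_inner inner_restrict[of _ _ e])
      also have "?Q (G (?Q e)) \<bullet> ?Q e = G (?Q e) \<bullet> ?Q e"
        using inner_restrict[of "- U" e "G (?Q e)"] by (simp add: inner_commute)
      finally have "S e \<bullet> e \<ge> (norm (?P e))\<^sup>2 + \<epsilon> * (norm (?Q e))\<^sup>2"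
        using G_coercive[of "?Q e"] by simp
      moreover have "min 1 \<epsilon> * (norm (?P e))\<^sup>2 \<le> 1 * (norm (?P e))\<^sup>2"
        "min 1 \<epsilon> * (norm (?Q e))\<^sup>2 \<le> \<epsilon> * (norm (?Q e))\<^sup>2"
        by (intro mult_right_mono; simp)+
      ultimately show ?thesis
        unfolding e distrib_left by linarith
    qed
  qed
  define N where "N e = e + ?Q (G (?P e))" for e
  have QGP: "bounded_linear (\<lambda>e. ?Q (G (?P e)))"
    by (intro bounded_linear_compose[OF bounded_linear_restrict bounded_linear_compose[OF G bounded_linear_restrict]])
  have "bounded_iso N"
    unfolding bounded_iso_def N_def
  proof (intro conjI exI[of _ "\<lambda>e. e - ?Q (G (?P e))"] allI)
    show "bounded_linear (\<lambda>e. e + ?Q (G (?P e)))" "bounded_linear (\<lambda>e. e - ?Q (G (?P e)))"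
      by (intro bounded_linear_add bounded_linear_sub bounded_linear_ident QGP)+
  qed (simp_all add: P.add P.diff Q.add Q.diff G.add G.diff PQ)
  moreover have "N (S (A c)) = ?P (A c) + ?Q (B c)" for c
  proof -
    have "N (S (A c)) = ?P (A c) + ?Q (G (?P (A c) + ?Q (A c)))"
      by (simp add: N_def S_def P.add Q.add G.add PQ(1-4) algebra_simps)
    then show ?thesis using PQ(5)[of "A c"] by (simp add: G_def A'(3))
  qed
  ultimately show ?thesis
    using bounded_iso_compose[OF \<open>bounded_iso N\<close> bounded_iso_compose[OF \<open>bounded_iso S\<close> A_iso]] by simp
qed

text \<open>Convolution with centred spline values as a finite combination of shifts, so that
  boundedness is immediate. For |x| \<le> 1 the window contains all nonzero values.\<close>

definition sample_op :: "nat \<Rightarrow> real \<Rightarrow> ell2 \<Rightarrow> ell2" where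
  "sample_op m x c = (\<Sum>j = - int (m + 1)..int (m + 1).
     Bspline m (x + real m / 2 + of_int j) *\<^sub>R shift j c)"

text \<open>The coefficients are shifted by \<open>\<lfloor>m/2\<rfloor>\<close> so that sampling on \<open>\<langle>m/2\<rangle> + x + \<int>\<close> becomes
  convolution with the values of the centred B-spline.\<close>
definition spline :: "nat \<Rightarrow> ell2 \<Rightarrow> real \<Rightarrow> real" where
  "spline m c x = (\<Sum>\<^sub>\<infinity>k. coord c (k + int (m div 2)) * Bspline m (x - of_int k))"

lemma bounded_linear_sample_op: "bounded_linear (sample_op m x)"
  unfolding sample_op_def
  by (intro bounded_linear_sum bounded_linear_scaleR_right bounded_linear_compose[OF _ bounded_linear_shift]
      bounded_linear_const_scaleR)

lemma coord_sample_op: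
  "coord (sample_op m x c) n = (\<Sum>j = - int (m + 1)..int (m + 1).
     Bspline m (x + real m / 2 + of_int j) * coord c (n - j))"
  by (simp add: sample_op_def)

lemma norm_sample_op_le:
  assumes "m \<ge> 2"
  shows "norm (sample_op m x c) \<le> real (2 * m + 3) * norm c"
proof -
  have "norm (sample_op m x c) \<le> (\<Sum>j = - int (m + 1)..int (m + 1). norm c)"
    unfolding sample_op_def
  proof (rule sum_norm_le)
    fix j
    show "norm (Bspline m (x + real m / 2 + of_int j) *\<^sub>R shift j c) \<le> norm c"
      using Bspline_bounds[OF assms, of "x + real m / 2 + of_int j"]
        mult_right_mono[of "Bspline m (x + real m / 2 + of_int j)" 1 "norm c"] by simp
  qed
  then show ?thesis by (simp add: algebra_simps)
qed

lemma shift_space_Bspline: "shift_space (Bspline m) = range (spline m)"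
proof (intro equalityI subsetI)
  fix f assume "f \<in> shift_space (Bspline m)"
  then obtain c where c: "(\<lambda>k. (c k)\<^sup>2) summable_on UNIV"
    "\<And>x. f x = (\<Sum>\<^sub>\<infinity>k. c k * Bspline m (x - of_int k))"
    unfolding shift_space_def by blast
  have "f = spline m (shift (int (m div 2)) (Abs_ell2 c))"
    by (rule ext) (simp add: spline_def c coord_Abs_ell2)
  then show "f \<in> range (spline m)" by blast
next
  fix f assume "f \<in> range (spline m)"
  then obtain c where f: "f = spline m c" by blast
  show "f \<in> shift_space (Bspline m)"
    unfolding shift_space_def
    using coord_square_summable[of "shift (- int (m div 2)) c"]
    by (auto simp: f spline_def intro!: exI[of _ "coord (shift (- int (m div 2)) c)"])
qed

lemma half_eq_frac_add: "real m / 2 = frac (real m / 2) + of_int (int (m div 2))"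
proof -
  have "\<lfloor>real m / 2\<rfloor> = int (m div 2)"
    using floor_divide_of_nat_eq[of m 2] by simp
  then show ?thesis by (simp add: frac_def)
qed

text \<open>The substitution j = n - m div 2 - k turns the spline series into a convolution, because
  m/2 is its fractional part plus m div 2.\<close>

lemma spline_at_sample:
  assumes "m \<ge> 2" "\<bar>x\<bar> \<le> 1"
  shows "spline m c (frac (real m / 2) + x + of_int n) = coord (sample_op m x c) n"
proof -
  define g where "g k = coord c (k + int (m div 2)) * Bspline m (frac (real m / 2) + x + of_int n - of_int k)" for k
  have bij: "bij (\<lambda>j. n - int (m div 2) - j)"
    by (rule bij_diff)
  have "spline m c (frac (real m / 2) + x + of_int n) = (\<Sum>\<^sub>\<infinity>k. g k)"
    by (simp add: spline_def g_def)
  also have "\<dots> = (\<Sum>\<^sub>\<infinity>j. g (n - int (m div 2) - j))"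
    using infsum_reindex_bij_betw[OF bij, of g] by simp
  also have "\<dots> = (\<Sum>\<^sub>\<infinity>j. Bspline m (x + real m / 2 + of_int j) * coord c (n - j))"
  proof (rule infsum_cong)
    fix j
    have "frac (real m / 2) + x + of_int n - of_int (n - int (m div 2) - j) = x + real m / 2 + of_int j"
      using half_eq_frac_add[of m] by simp
    then show "g (n - int (m div 2) - j) = Bspline m (x + real m / 2 + of_int j) * coord c (n - j)"
      unfolding g_def by (simp only: mult.commute) (simp add: algebra_simps)
  qed
  also have "\<dots> = (\<Sum>\<^sub>\<infinity>j\<in>{- int (m + 1)..int (m + 1)}. Bspline m (x + real m / 2 + of_int j) * coord c (n - j))"
    using Bspline_centered_eq_0[of m _ 1 x] assms by (intro infsum_cong_neutral) auto
  also have "\<dots> = coord (sample_op m x c) n"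
    by (simp add: coord_sample_op)
  finally show ?thesis .
qed

text \<open>The quadratic form bound applies to the real part of the symbol. One constant serves all
  offsets up to \<rho>, as integrating over offsets in the Riesz bounds requires.\<close>

lemma sample_op_coercive:
  assumes "m \<ge> 2" "0 \<le> \<rho>" "\<rho> < 1/2"
  obtains \<delta> where "\<delta> > 0" "\<And>x c. \<bar>x\<bar> \<le> \<rho> \<Longrightarrow> \<delta> * (norm c)\<^sup>2 \<le> sample_op m x c \<bullet> c"
proof -
  obtain \<delta> where \<delta>: "\<delta> > 0" "\<And>\<theta> x. \<bar>\<theta>\<bar> \<le> pi \<Longrightarrow> \<bar>x\<bar> \<le> \<rho> \<Longrightarrow> \<delta> \<le> Re (spline_symbol m \<theta> x)"
    using Re_spline_symbol_bounded_below[OF assms] by blast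
  have "\<delta> * (norm c)\<^sup>2 \<le> sample_op m x c \<bullet> c" if "\<bar>x\<bar> \<le> \<rho>" for x c
  proof -
    have "\<delta> * (norm c)\<^sup>2 \<le> (\<Sum>j = - int (m + 1)..int (m + 1). Bspline m (x + real m / 2 + of_int j) * (shift j c \<bullet> c))"
    proof (rule trig_polynomial_quadratic_form)
      fix \<theta> assume "\<theta> \<in> {- pi..pi}"
      then have "\<delta> \<le> Re (spline_symbol m \<theta> x)" using \<delta>(2) that by auto
      then show "\<delta> \<le> (\<Sum>j = - int (m + 1)..int (m + 1). Bspline m (x + real m / 2 + of_int j) * cos (of_int j * \<theta>))"
        using Re_spline_symbol_eq_sum[of m x \<theta>] assms that by simp
    qed simp
    then show ?thesis by (simp add: sample_op_def inner_sum_left)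
  qed
  with \<delta>(1) show ?thesis using that by blast
qed

text \<open>The form has symbol F_x times the conjugate of F_0, a double sum over differences of
  shifts. As F_0 is real, the real part is a product of two real parts bounded below.\<close>

lemma sample_op_paired_coercive:
  assumes "m \<ge> 2" "\<bar>x\<bar> < 1/2"
  obtains \<delta> where "\<delta> > 0" "\<And>c. \<delta> * (norm c)\<^sup>2 \<le> sample_op m x c \<bullet> sample_op m 0 c"
proof -
  obtain \<delta> where \<delta>: "\<delta> > 0" "\<And>\<theta> y. \<bar>\<theta>\<bar> \<le> pi \<Longrightarrow> \<bar>y\<bar> \<le> \<bar>x\<bar> \<Longrightarrow> \<delta> \<le> Re (spline_symbol m \<theta> y)"
    using Re_spline_symbol_bounded_below[OF assms(1) abs_ge_zero assms(2)] by blast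
  define J where "J = {- int (m + 1)..int (m + 1)}"
  define b where "b y j = Bspline m (y + real m / 2 + of_int j)" for y j
  have "\<delta> * \<delta> * (norm c)\<^sup>2 \<le> sample_op m x c \<bullet> sample_op m 0 c" for c
  proof -
    have "\<delta> * \<delta> * (norm c)\<^sup>2 \<le> (\<Sum>p\<in>J \<times> J. (b x (fst p) * b 0 (snd p)) * (shift (fst p - snd p) c \<bullet> c))"
    proof (rule trig_polynomial_quadratic_form)
      fix \<theta> assume \<theta>: "\<theta> \<in> {- pi..pi}"
      have re: "Re (spline_symbol m \<theta> y) = (\<Sum>j\<in>J. b y j * cos (of_int j * \<theta>))"
        "Im (spline_symbol m \<theta> y) = (\<Sum>j\<in>J. b y j * sin (of_int j * \<theta>))" if "\<bar>y\<bar> \<le> \<bar>x\<bar>" for y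
        using Re_spline_symbol_eq_sum[OF assms(1), of y \<theta>] Im_spline_symbol_eq_sum[OF assms(1), of y \<theta>]
          assms(2) that by (auto simp: J_def b_def)
      have "(\<Sum>p\<in>J \<times> J. (b x (fst p) * b 0 (snd p)) * cos (of_int (fst p - snd p) * \<theta>))
          = (\<Sum>i\<in>J. \<Sum>j\<in>J. (b x i * b 0 j) * cos (of_int (i - j) * \<theta>))"
        by (simp add: sum.cartesian_product case_prod_beta)
      also have "\<dots> = (\<Sum>i\<in>J. b x i * cos (of_int i * \<theta>)) * (\<Sum>j\<in>J. b 0 j * cos (of_int j * \<theta>))
          + (\<Sum>i\<in>J. b x i * sin (of_int i * \<theta>)) * (\<Sum>j\<in>J. b 0 j * sin (of_int j * \<theta>))"
        unfolding sum_product sum.distrib[symmetric]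
        by (simp add: left_diff_distrib cos_diff algebra_simps)
      also have "\<dots> = Re (spline_symbol m \<theta> x) * Re (spline_symbol m \<theta> 0)"
        using re[of x] re[of 0] Im_spline_symbol_0[OF assms(1), of \<theta>] by simp
      also have "\<dots> \<ge> \<delta> * \<delta>"
        using \<delta> \<theta> by (intro mult_mono) (auto intro: less_imp_le[THEN order_trans])
      finally show "\<delta> * \<delta> \<le> (\<Sum>p\<in>J \<times> J. (b x (fst p) * b 0 (snd p)) * cos (of_int (fst p - snd p) * \<theta>))" .
    qed (simp add: J_def)
    also have "\<dots> = (\<Sum>i\<in>J. \<Sum>j\<in>J. (b x i * b 0 j) * (shift i c \<bullet> shift j c))"
      by (simp add: sum.cartesian_product case_prod_beta inner_shift_shift)
    also have "\<dots> = sample_op m x c \<bullet> sample_op m 0 c"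
      by (subst sum.swap)
        (simp add: sample_op_def inner_sum_left inner_sum_right sum_distrib_left J_def b_def mult_ac)
    finally show ?thesis .
  qed
  with \<delta>(1) show ?thesis by (intro that[of "\<delta> * \<delta>"]) auto
qed

definition two_sided_op :: "nat \<Rightarrow> real \<Rightarrow> ell2 \<Rightarrow> ell2" where
  "two_sided_op m x c = restrict_ell2 {0..} (sample_op m 0 c) + restrict_ell2 (- {0..}) (sample_op m x c)"

lemma two_sided_op_bounded_iso:
  assumes "m \<ge> 2" "\<bar>x\<bar> < 1/2"
  shows "bounded_iso (two_sided_op m x)"
proof -
  obtain \<delta>1 where "\<delta>1 > 0" "\<And>y c. \<bar>y\<bar> \<le> 0 \<Longrightarrow> \<delta>1 * (norm c)\<^sup>2 \<le> sample_op m y c \<bullet> c"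
    by (rule sample_op_coercive[OF assms(1), of 0]) auto
  then have \<delta>1: "\<delta>1 > 0" "\<And>c. \<delta>1 * (norm c)\<^sup>2 \<le> sample_op m 0 c \<bullet> c"
    by simp_all
  obtain \<delta>2 where \<delta>2: "\<delta>2 > 0" "\<And>c. \<delta>2 * (norm c)\<^sup>2 \<le> sample_op m x c \<bullet> sample_op m 0 c"
    using sample_op_paired_coercive[OF assms] by blast
  define \<delta> where "\<delta> = min \<delta>1 \<delta>2"
  have le: "\<delta> * (norm c)\<^sup>2 \<le> \<delta>1 * (norm c)\<^sup>2" "\<delta> * (norm c)\<^sup>2 \<le> \<delta>2 * (norm c)\<^sup>2" for c :: ell2
    by (auto simp: \<delta>_def intro!: mult_right_mono)
  show ?thesis
    unfolding two_sided_op_def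
    using \<delta>1(1) \<delta>2(1) le[THEN order_trans] \<delta>1(2) \<delta>2(2)
    by (intro paired_operator_bounded_iso[where \<delta> = \<delta>] bounded_linear_sample_op) (auto simp: \<delta>_def)
qed

text \<open>The integer part of \<alpha> moves from the offset to the index: the negative half of
  the set reads the samples of offset \<open>x\<close> at the indices below
  \<open>s\<close>.\<close>

lemma spline_at_Lambda:
  assumes "m \<ge> 2" "\<bar>x\<bar> \<le> 1"
  shows "spline m c (Lambda m (x + of_int s) n) =
    (if n \<ge> 0 then coord (sample_op m 0 c) n else coord (sample_op m x c) (n + s))"
  using spline_at_sample[OF assms, of c "n + s"] spline_at_sample[OF assms(1), of 0 c n]
  by (simp add: Lambda_def algebra_simps)


section \<open>Riesz bounds for the integer translates\<close>

lemma spline_eq_floor_sum: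
  assumes "m \<ge> 2"
  shows "spline m c y = (\<Sum>j = 0..int m. coord c (\<lfloor>y\<rfloor> - j + int (m div 2)) * Bspline m (y - of_int \<lfloor>y\<rfloor> + of_int j))"
proof -
  define g where "g k = coord c (k + int (m div 2)) * Bspline m (y - of_int k)" for k
  have "Bspline m (y - of_int \<lfloor>y\<rfloor> + of_int j) = 0" if "j \<notin> {0..int m}" for j
  proof (rule Bspline_eq_0[OF assms])
    have "j \<le> -1 \<or> j \<ge> int m" using that by auto
    then have "real_of_int j \<le> -1 \<or> real_of_int j \<ge> real m" by linarith
    then show "y - of_int \<lfloor>y\<rfloor> + of_int j \<le> 0 \<or> y - of_int \<lfloor>y\<rfloor> + of_int j \<ge> real m"
      by linarith
  qed
  then have "(\<Sum>\<^sub>\<infinity>j. g (\<lfloor>y\<rfloor> - j)) = (\<Sum>\<^sub>\<infinity>j\<in>{0..int m}. g (\<lfloor>y\<rfloor> - j))"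
    by (intro infsum_cong_neutral) (auto simp: g_def algebra_simps)
  moreover have "spline m c y = infsum g UNIV"
    by (simp add: spline_def g_def[abs_def])
  moreover have "infsum g UNIV = (\<Sum>\<^sub>\<infinity>j. g (\<lfloor>y\<rfloor> - j))"
    using infsum_reindex_bij_betw[OF bij_diff[of "\<lfloor>y\<rfloor>"], of g] by simp
  ultimately show ?thesis
    by (simp add: g_def algebra_simps)
qed

lemma borel_measurable_spline:
  assumes "m \<ge> 2"
  shows "spline m c \<in> borel_measurable borel"
proof -
  have [measurable]: "Bspline m \<in> borel_measurable borel"
    by (rule borel_measurable_continuous_onI[OF continuous_on_Bspline[OF assms]])
  have [measurable]: "(\<lambda>y::real. coord c (\<lfloor>y\<rfloor> - j + int (m div 2))) \<in> borel_measurable borel" for j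
  proof -
    have "(\<lambda>k. coord c (k - j + int (m div 2))) \<in> borel_measurable (count_space UNIV)"
      by simp
    from measurable_compose[OF measurable_real_floor this] show ?thesis by simp
  qed
  have "(\<lambda>y. \<Sum>j = 0..int m. coord c (\<lfloor>y\<rfloor> - j + int (m div 2)) * Bspline m (y - of_int \<lfloor>y\<rfloor> + of_int j))
      \<in> borel_measurable borel"
    by measurable
  then show ?thesis
    by (simp only: spline_eq_floor_sum[OF assms, of c, symmetric])
qed

text \<open>The integer translates of the half-open unit interval around \<open>t\<close> tile the
  line; Tonelli exchanges sum and integral.\<close>

lemma nn_integral_periodize:
  fixes f :: "real \<Rightarrow> ennreal"
  assumes [measurable]: "f \<in> borel_measurable borel"
  shows "(\<integral>\<^sup>+y. f y \<partial>lborel) =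
    (\<integral>\<^sup>+x. (\<integral>\<^sup>+n. f (t + x + of_int n) \<partial>count_space UNIV) * indicator {-1/2..<1/2} x \<partial>lborel)"
proof -
  let ?I = "{-1/2..<1/2 :: real}"
  have one: "(\<integral>\<^sup>+n. f y * indicator ?I (y - t - of_int n) \<partial>count_space UNIV) = f y" for y
  proof -
    have "indicator ?I (y - t - of_int n) = (indicator {\<lfloor>y - t + 1/2\<rfloor>} n :: ennreal)" for n
    proof -
      have "y - t - of_int n \<in> ?I \<longleftrightarrow> \<lfloor>y - t + 1/2\<rfloor> = n"
        unfolding floor_eq_iff by auto
      then show ?thesis by (auto simp: indicator_def)
    qed
    then show ?thesis
      by (simp add: nn_integral_cmult)
  qed
  have "(\<integral>\<^sup>+y. f y \<partial>lborel) = (\<integral>\<^sup>+y. \<integral>\<^sup>+n. f y * indicator ?I (y - t - of_int n) \<partial>count_space UNIV \<partial>lborel)"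
    by (simp only: one)
  also have "\<dots> = (\<integral>\<^sup>+n. \<integral>\<^sup>+y. f y * indicator ?I (y - t - of_int n) \<partial>lborel \<partial>count_space UNIV)"
    by (rule nn_integral_count_space_nn_integral) auto
  also have "\<dots> = (\<integral>\<^sup>+n. \<integral>\<^sup>+x. f (t + x + of_int n) * indicator ?I x \<partial>lborel \<partial>count_space UNIV)"
  proof (rule nn_integral_cong)
    fix n :: int
    show "(\<integral>\<^sup>+y. f y * indicator ?I (y - t - of_int n) \<partial>lborel) = (\<integral>\<^sup>+x. f (t + x + of_int n) * indicator ?I x \<partial>lborel)"
      using nn_integral_real_affine[of "\<lambda>y. f y * indicator ?I (y - t - of_int n)" 1 "t + of_int n"]
      by (simp add: algebra_simps)
  qed
  also have "\<dots> = (\<integral>\<^sup>+x. \<integral>\<^sup>+n. f (t + x + of_int n) * indicator ?I x \<partial>count_space UNIV \<partial>lborel)"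
    by (rule nn_integral_count_space_nn_integral[symmetric]) auto
  also have "\<dots> = (\<integral>\<^sup>+x. (\<integral>\<^sup>+n. f (t + x + of_int n) \<partial>count_space UNIV) * indicator ?I x \<partial>lborel)"
    by (intro nn_integral_cong nn_integral_multc) auto
  finally show ?thesis .
qed

lemma nn_integral_coord_square:
  "(\<integral>\<^sup>+n. ennreal ((coord c n)\<^sup>2) \<partial>count_space UNIV) = ennreal ((norm c)\<^sup>2)"
proof -
  have "Infinite_Set_Sum.abs_summable_on (\<lambda>n. (coord c n)\<^sup>2) UNIV"
    using coord_square_summable[of c] by (simp add: abs_summable_equivalent[symmetric])
  then show ?thesis
    by (simp add: nn_integral_conv_infsetsum infsetsum_infsum norm_ell2_square)
qed

text \<open>Periodizing around \<open>frac (real m / 2)\<close> writes the squared norm as the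
  integral over x in [-1/2, 1/2) of the squared norm of \<open>sample_op m x c\<close>. The upper
  bound is uniform in x; the lower one uses |x| \<le> 1/4, where coercivity is uniform.\<close>

lemma spline_Riesz_bounds:
  assumes "m \<ge> 2"
  obtains a b where "a > 0" "b > 0"
    "\<And>c. a * (norm c)\<^sup>2 \<le> L2_norm_sq (spline m c)" "\<And>c. L2_norm_sq (spline m c) \<le> b * (norm c)\<^sup>2"
proof -
  obtain \<delta> where \<delta>: "\<delta> > 0" "\<And>x c. \<bar>x\<bar> \<le> 1/4 \<Longrightarrow> \<delta> * (norm c)\<^sup>2 \<le> sample_op m x c \<bullet> c"
    by (rule sample_op_coercive[OF assms, of "1/4"]) auto
  define K where "K = real (2 * m + 3)"
  have "K > 0" by (simp add: K_def)
  have bounds: "\<delta>\<^sup>2 / 2 * (norm c)\<^sup>2 \<le> L2_norm_sq (spline m c) \<and> L2_norm_sq (spline m c) \<le> K\<^sup>2 * (norm c)\<^sup>2" for c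
  proof -
    let ?I = "{-1/2..<1/2 :: real}"
    have [measurable]: "spline m c \<in> borel_measurable borel"
      by (rule borel_measurable_spline[OF assms])
    have "(\<integral>\<^sup>+y. ennreal ((spline m c y)\<^sup>2) \<partial>lborel) =
        (\<integral>\<^sup>+x. (\<integral>\<^sup>+n. ennreal ((spline m c (frac (real m / 2) + x + of_int n))\<^sup>2) \<partial>count_space UNIV) * indicator ?I x \<partial>lborel)"
      by (rule nn_integral_periodize) simp
    also have "\<dots> = (\<integral>\<^sup>+x. ennreal ((norm (sample_op m x c))\<^sup>2) * indicator ?I x \<partial>lborel)"
    proof (rule nn_integral_cong)
      fix x :: real
      show "(\<integral>\<^sup>+n. ennreal ((spline m c (frac (real m / 2) + x + of_int n))\<^sup>2) \<partial>count_space UNIV) * indicator ?I x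
          = ennreal ((norm (sample_op m x c))\<^sup>2) * indicator ?I x"
      proof (cases "x \<in> ?I")
        case True
        then have "\<bar>x\<bar> \<le> 1" by auto
        then show ?thesis by (simp add: spline_at_sample[OF assms] nn_integral_coord_square)
      qed simp
    qed
    finally have eq: "(\<integral>\<^sup>+y. ennreal ((spline m c y)\<^sup>2) \<partial>lborel) =
        (\<integral>\<^sup>+x. ennreal ((norm (sample_op m x c))\<^sup>2) * indicator ?I x \<partial>lborel)" .
    have "(\<integral>\<^sup>+x. ennreal ((norm (sample_op m x c))\<^sup>2) * indicator ?I x \<partial>lborel)
        \<le> (\<integral>\<^sup>+x. ennreal (K\<^sup>2 * (norm c)\<^sup>2) * indicator ?I x \<partial>lborel)"
    proof (intro nn_integral_mono mult_right_mono ennreal_leI)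
      show "(norm (sample_op m x c))\<^sup>2 \<le> K\<^sup>2 * (norm c)\<^sup>2" for x
        using power_mono[OF norm_sample_op_le[OF assms, of x c] norm_ge_zero, of 2]
        by (simp add: K_def power_mult_distrib)
    qed simp
    also have "\<dots> = ennreal (K\<^sup>2 * (norm c)\<^sup>2)"
      by (simp add: nn_integral_cmult)
    finally have upper: "(\<integral>\<^sup>+y. ennreal ((spline m c y)\<^sup>2) \<partial>lborel) \<le> ennreal (K\<^sup>2 * (norm c)\<^sup>2)"
      by (simp add: eq)
    \<comment> \<open>The factor 1/2 is the length of the interval [-1/4, 1/4].\<close>
    have "ennreal (\<delta>\<^sup>2 / 2 * (norm c)\<^sup>2) = ennreal (\<delta>\<^sup>2 * (norm c)\<^sup>2) * ennreal (1/2)"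
      by (subst ennreal_mult[symmetric]) auto
    also have "\<dots> = (\<integral>\<^sup>+x. ennreal (\<delta>\<^sup>2 * (norm c)\<^sup>2) * indicator {-1/4..1/4::real} x \<partial>lborel)"
      by (simp add: nn_integral_cmult)
    also have "\<dots> \<le> (\<integral>\<^sup>+x. ennreal ((norm (sample_op m x c))\<^sup>2) * indicator ?I x \<partial>lborel)"
    proof (rule nn_integral_mono)
      fix x :: real
      show "ennreal (\<delta>\<^sup>2 * (norm c)\<^sup>2) * indicator {-1/4..1/4} x
          \<le> ennreal ((norm (sample_op m x c))\<^sup>2) * indicator ?I x"
      proof (cases "x \<in> {-1/4..1/4}")
        case True
        then have "\<bar>x\<bar> \<le> 1/4" by auto
        have "\<delta> * norm c \<le> norm (sample_op m x c)"
        proof (cases "c = 0")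
          case False
          have "(\<delta> * norm c) * norm c \<le> sample_op m x c \<bullet> c"
            using \<delta>(2)[OF \<open>\<bar>x\<bar> \<le> 1/4\<close>, of c] by (simp add: power2_eq_square mult.assoc)
          also have "\<dots> \<le> norm (sample_op m x c) * norm c" by (rule norm_cauchy_schwarz)
          finally show ?thesis using False by simp
        qed simp
        then have "(\<delta> * norm c)\<^sup>2 \<le> (norm (sample_op m x c))\<^sup>2"
          using \<delta>(1) by (intro power_mono) auto
        then show ?thesis using True by (simp add: power_mult_distrib ennreal_leI)
      qed simp
    qed
    finally have lower: "ennreal (\<delta>\<^sup>2 / 2 * (norm c)\<^sup>2) \<le> (\<integral>\<^sup>+y. ennreal ((spline m c y)\<^sup>2) \<partial>lborel)"
      by (simp add: eq)
    \<comment> \<open>An infinite integral would be read as 0 here; \<open>upper\<close> excludes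
      that.\<close>
    have "L2_norm_sq (spline m c) = enn2real (\<integral>\<^sup>+y. ennreal ((spline m c y)\<^sup>2) \<partial>lborel)"
      unfolding L2_norm_sq_def by (intro integral_eq_nn_integral) auto
    then show ?thesis
      using enn2real_mono[OF upper] enn2real_mono[OF lower] upper
      by (simp add: le_less_trans[OF upper])
  qed
  show ?thesis
    by (rule that[of "\<delta>\<^sup>2 / 2" "K\<^sup>2"]) (use bounds \<delta>(1) \<open>K > 0\<close> in auto)
qed

section \<open>Alternating blocks at offset 1/2\<close>

lemma sum_spline_samples_half:
  assumes "m \<ge> 2"
  shows "(\<Sum>j = - int (m + 1)..int (m + 1). Bspline m (1/2 + real m / 2 + of_int j) * cos (of_int j * pi)) = 0"
  using Re_spline_symbol_eq_sum[of m "1/2" pi] spline_symbol_half[OF assms] assms by simp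

text \<open>A block of L alternating signs has squared norm L, but its samples at offset 1/2 vanish
  wherever the convolution window lies wholly inside or outside the block. Only boundedly many
  indices near the two ends contribute.\<close>

lemma sample_op_half_not_bounded_below:
  assumes "m \<ge> 2"
  obtains C where "\<And>L. \<exists>c. (norm c)\<^sup>2 = real L \<and> (norm (sample_op m (1/2) c))\<^sup>2 \<le> C
    \<and> (\<forall>n\<ge>0. coord (sample_op m 0 c) n = 0)"
proof -
  define M where "M = int (m + 1)"
  define b where "b j = Bspline m (1/2 + real m / 2 + of_int j)" for j
  \<comment> \<open>At most 2 (2 m + 3) indices near the ends, each with a value of size at most 2 m
    + 3.\<close>
  define C where "C = real (2 * (2 * m + 3)) * (real (2 * m + 3))\<^sup>2"
  have "\<exists>c. (norm c)\<^sup>2 = real L \<and> (norm (sample_op m (1/2) c))\<^sup>2 \<le> C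
    \<and> (\<forall>n\<ge>0. coord (sample_op m 0 c) n = 0)" for L
  proof -
    \<comment> \<open>A block below -M is out of reach of every window centred at n \<ge> 0.\<close>
    define I where "I = {- M - int L..<- M}"
    define u where "u k = (if k \<in> I then cos (of_int k * pi) else 0)" for k
    have "finite I" by (simp add: I_def)
    have cos_sq: "(cos (of_int k * pi))\<^sup>2 = 1" for k
      using sin_npi_int[of k] sin_cos_squared_add[of "of_int k * pi"] by (simp add: mult.commute)
    have "(\<lambda>k. (u k)\<^sup>2) summable_on UNIV \<longleftrightarrow> (\<lambda>k. (u k)\<^sup>2) summable_on I"
      by (rule summable_on_cong_neutral) (auto simp: u_def)
    then have "(\<lambda>k. (u k)\<^sup>2) summable_on UNIV" using \<open>finite I\<close> by simp
    then have coord_c: "coord (Abs_ell2 u) = u" by (rule coord_Abs_ell2)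
    define c where "c = Abs_ell2 u"
    have c: "coord c k = u k" for k by (simp add: c_def coord_c)
    have "(norm c)\<^sup>2 = (\<Sum>\<^sub>\<infinity>k\<in>I. 1)"
      unfolding norm_ell2_square by (rule infsum_cong_neutral) (auto simp: c u_def cos_sq)
    then have norm_c: "(norm c)\<^sup>2 = real L" by (simp add: I_def)
    let ?W = "{- M - int L - M..- M - int L + M} \<union> {- M - M..- M + M}"
    have u_le: "\<bar>u k\<bar> \<le> 1" for k by (simp add: u_def)
    have value_le: "\<bar>coord (sample_op m (1/2) c) n\<bar> \<le> real (2 * m + 3)" for n
    proof -
      have "\<bar>coord (sample_op m (1/2) c) n\<bar> \<le> (\<Sum>j = - int (m + 1)..int (m + 1). \<bar>b j * u (n - j)\<bar>)"
        unfolding coord_sample_op b_def c by (rule sum_abs)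
      also have "\<dots> \<le> (\<Sum>j = - int (m + 1)..int (m + 1). 1)"
      proof (rule sum_mono)
        fix j show "\<bar>b j * u (n - j)\<bar> \<le> 1"
          using Bspline_bounds[OF assms, of "1/2 + real m / 2 + of_int j"] u_le[of "n - j"]
          by (auto simp: abs_mult b_def intro: mult_le_one)
      qed
      finally show ?thesis by (simp add: algebra_simps)
    qed
    have value_0: "coord (sample_op m (1/2) c) n = 0" if "n \<notin> ?W" for n
    proof -
      have "(- M - int L + M < n \<and> n < - M - M) \<or> n < - M - int L - M \<or> - M + M < n"
        using that by auto
      then consider "\<forall>j\<in>{- M..M}. n - j \<in> I" | "\<forall>j\<in>{- M..M}. n - j \<notin> I"
        by (elim disjE) (auto simp: I_def)
      then show ?thesis
      proof cases
        case 1
        have "coord (sample_op m (1/2) c) n = (\<Sum>j\<in>{- M..M}. b j * cos (of_int (n - j) * pi))"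
          unfolding coord_sample_op b_def c using 1 by (intro sum.cong) (auto simp: M_def u_def)
        also have "\<dots> = (\<Sum>j\<in>{- M..M}. cos (of_int n * pi) * (b j * cos (of_int j * pi)))"
        proof (rule sum.cong)
          fix j
          have "sin (of_int j * pi) = 0" using sin_npi_int[of j] by (simp add: mult.commute)
          then show "b j * cos (of_int (n - j) * pi) = cos (of_int n * pi) * (b j * cos (of_int j * pi))"
            by (simp add: left_diff_distrib cos_diff)
        qed simp
        also have "\<dots> = 0"
          using sum_spline_samples_half[OF assms] by (simp add: sum_distrib_left[symmetric] b_def M_def)
        finally show ?thesis .
      next
        case 2
        then show ?thesis
          unfolding coord_sample_op c by (intro sum.neutral) (auto simp: M_def u_def)
      qed
    qed
    have "(norm (sample_op m (1/2) c))\<^sup>2 = (\<Sum>\<^sub>\<infinity>n\<in>?W. (coord (sample_op m (1/2) c) n)\<^sup>2)"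
      unfolding norm_ell2_square by (rule infsum_cong_neutral) (auto intro: value_0)
    also have "\<dots> = (\<Sum>n\<in>?W. (coord (sample_op m (1/2) c) n)\<^sup>2)"
      by simp
    also have "\<dots> \<le> of_nat (card ?W) * (real (2 * m + 3))\<^sup>2"
    proof (rule sum_bounded_above)
      show "(coord (sample_op m (1/2) c) n)\<^sup>2 \<le> (real (2 * m + 3))\<^sup>2" for n
        using power_mono[OF value_le[of n] abs_ge_zero, of 2] by simp
    qed
    also have "\<dots> \<le> C"
    proof -
      have "card ?W \<le> card {- M - int L - M..- M - int L + M} + card {- M - M..- M + M}"
        by (rule card_Un_le)
      also have "\<dots> = 2 * (2 * m + 3)" by (simp add: M_def)
      finally show ?thesis unfolding C_def by (intro mult_right_mono) auto
    qed
    finally have "(norm (sample_op m (1/2) c))\<^sup>2 \<le> C" .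
    moreover have "coord (sample_op m 0 c) n = 0" if "n \<ge> 0" for n
      unfolding coord_sample_op c using that by (intro sum.neutral) (auto simp: u_def I_def M_def)
    ultimately show ?thesis using norm_c by blast
  qed
  then show ?thesis using that by blast
qed

section \<open>Offsets below one half, and the obstructions beyond\<close>

lemma spline_at_Lambda_two_sided:
  assumes "m \<ge> 2" "\<bar>x\<bar> \<le> 1"
  shows "spline m c (Lambda m x n) = coord (two_sided_op m x c) n"
  using spline_at_Lambda[OF assms, of c 0 n] by (simp add: two_sided_op_def)

text \<open>The samples are an isomorphism applied to the coefficients: its two-sided bounds and the
  Riesz bounds give stability, its surjectivity gives interpolation.\<close>

lemma complete_interpolation_of_abs_less_half:
  assumes "m \<ge> 2" "\<bar>\<alpha>\<bar> < 1/2"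
  shows "complete_interpolation_set (Lambda m \<alpha>) (shift_space (Bspline m))"
proof -
  let ?T = "two_sided_op m \<alpha>"
  have samples: "spline m c (Lambda m \<alpha> n) = coord (?T c) n" for c n
    using assms by (intro spline_at_Lambda_two_sided) auto
  have iso: "bounded_iso ?T" by (rule two_sided_op_bounded_iso[OF assms])
  obtain A B where AB: "A > 0" "B > 0" "\<And>c. A * norm c \<le> norm (?T c)" "\<And>c. norm (?T c) \<le> B * norm c"
    using bounded_iso_bounds[OF iso] by blast
  obtain a b where ab: "a > 0" "b > 0"
    "\<And>c. a * (norm c)\<^sup>2 \<le> L2_norm_sq (spline m c)" "\<And>c. L2_norm_sq (spline m c) \<le> b * (norm c)\<^sup>2"
    using spline_Riesz_bounds[OF assms(1)] by blast
  have "stable_sampling (Lambda m \<alpha>) (range (spline m))"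
    unfolding stable_sampling_def
  proof (rule exI[of _ "A\<^sup>2 / b"], rule exI[of _ "B\<^sup>2 / a"], intro conjI ballI)
    fix f assume "f \<in> range (spline m)"
    then obtain c where f: "f = spline m c" by blast
    have sum_eq: "(\<Sum>\<^sub>\<infinity>n. (f (Lambda m \<alpha> n))\<^sup>2) = (norm (?T c))\<^sup>2"
      by (simp add: f samples norm_ell2_square)
    show "(\<lambda>n. (f (Lambda m \<alpha> n))\<^sup>2) summable_on UNIV"
      by (simp add: f samples coord_square_summable)
    have "A\<^sup>2 / b * L2_norm_sq f \<le> A\<^sup>2 / b * (b * (norm c)\<^sup>2)"
      using ab AB by (intro mult_left_mono) (auto simp: f)
    also have "\<dots> = (A * norm c)\<^sup>2" using ab by (simp add: power_mult_distrib)
    also have "\<dots> \<le> (norm (?T c))\<^sup>2" using AB by (intro power_mono) auto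
    finally show "A\<^sup>2 / b * L2_norm_sq f \<le> (\<Sum>\<^sub>\<infinity>n. (f (Lambda m \<alpha> n))\<^sup>2)"
      by (simp add: sum_eq)
    have "(norm (?T c))\<^sup>2 \<le> (B * norm c)\<^sup>2" using AB by (intro power_mono) auto
    also have "\<dots> = B\<^sup>2 / a * (a * (norm c)\<^sup>2)" using ab by (simp add: power_mult_distrib)
    also have "\<dots> \<le> B\<^sup>2 / a * L2_norm_sq f"
      using ab AB by (intro mult_left_mono) (auto simp: f)
    finally show "(\<Sum>\<^sub>\<infinity>n. (f (Lambda m \<alpha> n))\<^sup>2) \<le> B\<^sup>2 / a * L2_norm_sq f"
      by (simp add: sum_eq)
  qed (use AB ab in auto)
  moreover have "interpolation_set (Lambda m \<alpha>) (range (spline m))"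
    unfolding interpolation_set_def
  proof (intro allI impI)
    fix d :: "int \<Rightarrow> real" assume d: "(\<lambda>n. (d n)\<^sup>2) summable_on UNIV"
    obtain c where "?T c = Abs_ell2 d"
      using bounded_iso_bij[OF iso] by (metis bij_pointE)
    then have "spline m c (Lambda m \<alpha> n) = d n" for n
      using d by (simp add: samples coord_Abs_ell2)
    then show "\<exists>f\<in>range (spline m). \<forall>n. f (Lambda m \<alpha> n) = d n" by blast
  qed
  ultimately show ?thesis
    by (simp add: complete_interpolation_set_def shift_space_Bspline)
qed

lemma unit_square_summable: "(\<lambda>n. (of_bool (n = k) :: real)\<^sup>2) summable_on (UNIV :: int set)"
proof -
  have "(\<lambda>n. (of_bool (n = k) :: real)\<^sup>2) summable_on UNIV \<longleftrightarrow> (\<lambda>n. (of_bool (n = k) :: real)\<^sup>2) summable_on {k}"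
    by (rule summable_on_cong_neutral) auto
  then show ?thesis by simp
qed

text \<open>The set has \<open>s\<close> points more than \<open>Lambda m x\<close>, which is already a set of unique determination.\<close>
lemma not_interpolation_of_extra_points:
  assumes "m \<ge> 2" "\<bar>x\<bar> < 1/2" "s > 0"
  shows "\<not> interpolation_set (Lambda m (x + of_int s)) (shift_space (Bspline m))"
proof
  assume "interpolation_set (Lambda m (x + of_int s)) (shift_space (Bspline m))"
  \<comment> \<open>The datum 1 sits at index -1, which reads offset \<open>x\<close> at s - 1 \<ge>
    0 and so is an extra point.\<close>
  then have "\<exists>f\<in>range (spline m). \<forall>n. f (Lambda m (x + of_int s) n) = of_bool (n = -1)"
    unfolding interpolation_set_def shift_space_Bspline
    using unit_square_summable[of "-1"] by (elim allE[of _ "\<lambda>n. of_bool (n = -1)"] impE)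
  then obtain c where c: "\<And>n. spline m c (Lambda m (x + of_int s) n) = of_bool (n = -1)"
    by blast
  note at = spline_at_Lambda[OF assms(1), of x c s]
  have "two_sided_op m x c = 0"
  proof (rule ell2_eqI)
    fix N
    show "coord (two_sided_op m x c) N = coord 0 N"
    proof (cases "N \<ge> 0")
      case True
      then show ?thesis using at[of N] c[of N] assms(2) by (simp add: two_sided_op_def)
    next
      case False
      \<comment> \<open>Here N - s < -1, so the prescribed value is 0.\<close>
      then show ?thesis using at[of "N - s"] c[of "N - s"] assms(2,3) by (simp add: two_sided_op_def)
    qed
  qed
  moreover have "two_sided_op m x 0 = 0"
    using bounded_iso_bounded_linear[OF two_sided_op_bounded_iso[OF assms(1,2)]]
    by (rule linear_0[OF bounded_linear.linear])
  ultimately have "c = 0"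
    using bounded_iso_bij[OF two_sided_op_bounded_iso[OF assms(1,2)]] by (metis bij_pointE)
  then show False using c[of "-1"] by (simp add: spline_def)
qed

text \<open>For negative \<open>s\<close> the samples of offset \<open>x\<close> at the indices from
  s to -1 are missing. The spline that \<open>two_sided_op\<close> sends to the unit sequence at -1
  is nonzero but vanishes at all remaining points.\<close>

lemma not_stable_sampling_of_missing_points:
  assumes "m \<ge> 2" "\<bar>x\<bar> < 1/2" "s < 0"
  shows "\<not> stable_sampling (Lambda m (x + of_int s)) (shift_space (Bspline m))"
proof
  assume "stable_sampling (Lambda m (x + of_int s)) (shift_space (Bspline m))"
  then obtain A where A: "A > 0"
    "\<And>c. A * L2_norm_sq (spline m c) \<le> (\<Sum>\<^sub>\<infinity>n. (spline m c (Lambda m (x + of_int s) n))\<^sup>2)"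
    unfolding stable_sampling_def shift_space_Bspline by blast
  obtain a where a: "a > 0" "\<And>c. a * (norm c)\<^sup>2 \<le> L2_norm_sq (spline m c)"
    using spline_Riesz_bounds[OF assms(1)] by metis
  obtain c where "two_sided_op m x c = Abs_ell2 (\<lambda>n. of_bool (n = -1))"
    using bounded_iso_bij[OF two_sided_op_bounded_iso[OF assms(1,2)]] by (metis bij_pointE)
  then have c: "coord (two_sided_op m x c) N = of_bool (N = -1)" for N
    using unit_square_summable[of "-1"] by (simp add: coord_Abs_ell2)
  have "spline m c (Lambda m (x + of_int s) n) = 0" for n
    using spline_at_Lambda[OF assms(1), of x c s n] c[of n] c[of "n + s"] assms(2,3)
    by (auto simp: two_sided_op_def)
  then have "A * L2_norm_sq (spline m c) \<le> 0" using A(2)[of c] by simp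
  then have "(norm c)\<^sup>2 \<le> 0" 
  proof -
    have "L2_norm_sq (spline m c) \<le> 0" using \<open>A * L2_norm_sq (spline m c) \<le> 0\<close> A(1) by (simp add: mult_le_0_iff)
    then have "a * (norm c)\<^sup>2 \<le> 0" using a(2)[of c] by linarith
    then show ?thesis using a(1) by (simp add: mult_le_0_iff)
  qed
  then have "c = 0" by simp
  then show False using c[of "-1"] by (simp add: two_sided_op_def coord_sample_op)
qed

text \<open>Alternating blocks have samples 0 at nonnegative indices, and the squares of the others
  have a sum bounded independently of the length; a lower sampling bound would bound the
  length.\<close>

lemma not_stable_sampling_of_half_integer:
  assumes "m \<ge> 2"
  shows "\<not> stable_sampling (Lambda m (1/2 + of_int s)) (shift_space (Bspline m))"
proof
  assume "stable_sampling (Lambda m (1/2 + of_int s)) (shift_space (Bspline m))"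
  then obtain A where A: "A > 0"
    "\<And>c. (\<lambda>n. (spline m c (Lambda m (1/2 + of_int s) n))\<^sup>2) summable_on UNIV"
    "\<And>c. A * L2_norm_sq (spline m c) \<le> (\<Sum>\<^sub>\<infinity>n. (spline m c (Lambda m (1/2 + of_int s) n))\<^sup>2)"
    unfolding stable_sampling_def shift_space_Bspline by blast
  obtain a where a: "a > 0" "\<And>c. a * (norm c)\<^sup>2 \<le> L2_norm_sq (spline m c)"
    using spline_Riesz_bounds[OF assms(1)] by metis
  obtain C where C: "\<And>L. \<exists>c. (norm c)\<^sup>2 = real L \<and> (norm (sample_op m (1/2) c))\<^sup>2 \<le> C
    \<and> (\<forall>n\<ge>0. coord (sample_op m 0 c) n = 0)"
    using sample_op_half_not_bounded_below[OF assms] by blast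
  obtain L :: nat where L: "C / (A * a) < real L" using reals_Archimedean2 by blast
  obtain c where c: "(norm c)\<^sup>2 = real L" "(norm (sample_op m (1/2) c))\<^sup>2 \<le> C"
    "\<And>n. n \<ge> 0 \<Longrightarrow> coord (sample_op m 0 c) n = 0"
    using C[of L] by blast
  have "A * (a * real L) \<le> A * L2_norm_sq (spline m c)"
    using a(2)[of c] A(1) by (simp add: c(1))
  also have "\<dots> \<le> (\<Sum>\<^sub>\<infinity>n. (spline m c (Lambda m (1/2 + of_int s) n))\<^sup>2)"
    by (rule A(3))
  \<comment> \<open>The shift matches n with n + s for negative n; the sum is then enlarged to all
    integers.\<close>
  also have "\<dots> \<le> (\<Sum>\<^sub>\<infinity>n. (coord (shift (- s) (sample_op m (1/2) c)) n)\<^sup>2)"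
    using spline_at_Lambda[OF assms, of "1/2" c s] c(3)
    by (intro infsum_mono A(2) coord_square_summable) auto
  also have "\<dots> = (norm (sample_op m (1/2) c))\<^sup>2"
    by (simp only: norm_ell2_square[symmetric] norm_shift)
  also have "\<dots> \<le> C" by (rule c(2))
  finally show False
    using L A(1) a(1) by (simp add: field_simps)
qed

theorem theorem5p2:
  fixes m :: nat and \<alpha> :: real
  assumes "m \<ge> 2"
  shows "complete_interpolation_set (Lambda m \<alpha>) (shift_space (Bspline m)) \<longleftrightarrow> \<bar>\<alpha>\<bar> < 1/2"
proof
  assume "\<bar>\<alpha>\<bar> < 1/2"
  then show "complete_interpolation_set (Lambda m \<alpha>) (shift_space (Bspline m))"
    using assms by (rule complete_interpolation_of_abs_less_half[rotated])
next
  assume cis: "complete_interpolation_set (Lambda m \<alpha>) (shift_space (Bspline m))"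
  \<comment> \<open>Rounding to a nearest integer; ties give x = -1/2.\<close>
  define s where "s = \<lfloor>\<alpha> + 1/2\<rfloor>"
  define x where "x = \<alpha> - of_int s"
  have x: "- (1/2) \<le> x" "x < 1/2" by (auto simp: x_def s_def) linarith+
  have \<alpha>: "\<alpha> = x + of_int s" by (simp add: x_def)
  show "\<bar>\<alpha>\<bar> < 1/2"
  proof (cases "x = - (1/2)")
    case True
    then have "\<alpha> = 1/2 + of_int (s - 1)" by (simp add: \<alpha>)
    then show ?thesis
      using cis not_stable_sampling_of_half_integer[OF assms] unfolding complete_interpolation_set_def by metis
  next
    case False
    with x have x': "\<bar>x\<bar> < 1/2" by auto
    \<comment> \<open>A positive \<open>s\<close> contradicts interpolation, a negative one stable
      sampling.\<close>
    have "s = 0"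
      using cis not_interpolation_of_extra_points[OF assms x'] not_stable_sampling_of_missing_points[OF assms x']
      unfolding \<alpha> complete_interpolation_set_def by (metis linorder_neqE)
    then show ?thesis using x' by (simp add: \<alpha>)
  qed
qed

end
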